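(* The categories $\overline{{\sf 1C}}^{\,\star}$ and $\overline{{\sf HBrcd}}^{\,\star}$ are isomorphic.
   Context: ${\sf C}$ is a strict braided monoidal category with tensor product $\otimes$, unit object $K$ and braiding $c$. For an object $P$ and a morphism $f$, write $P\otimes f$ for $id_P\otimes f$ and $f\otimes P$ for $f\otimes id_P$. Algebras $(A,\eta_A,\mu_A)$, coalgebras $(D,\varepsilon_D,\delta_D)$, and Hopf algebras $X=(X,\eta_X,\mu_X,\varepsilon_X,\delta_X,\lambda_X)$ (with antipode $\lambda_X$) are taken in ${\sf C}$; tensor products have structures $\mu_{A\otimes B}=(\mu_A\otimes\mu_B)\circ(A\otimes c_{B,A}\otimes B)$ and $\delta_{D\otimes E}=(D\otimes c_{D,E}\otimes E)\circ(\delta_D\otimes\delta_E)$, with the obvious units and counits. A morphism of Hopf algebras is a morphism that is both an algebra and a coalgebra morphism. A Hopf bracoid in ${\sf C}$ is a triple $(H,B,\varphi_B)$ where $H,B$ are Hopf algebras in ${\sf C}$ and $(B,\varphi_B)$ is a left $H$-module such that $$\varphi_{B}\circ(H\otimes\mu_{B})=\mu_{B}\circ (\varphi_{B}\otimes\Phi_{B})\circ(H\otimes c_{H,B}\otimes B)\circ(\delta_{H}\otimes B\otimes B),$$ where $\Phi_{B}= \mu_{B}\circ((\lambda_{B}\circ u_{\varphi_{B}})\otimes\varphi_{B})\circ(\delta_{H}\otimes B)$ and $u_{\varphi_{B}}=\varphi_{B}\circ(H\otimes\eta_{B})$. A morphism of Hopf bracoids $(H,B,\varphi_B)\to(H',B',\varphi_{B'})$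 is a pair $(f,g)$ of Hopf algebra morphisms $f\colon H\to H'$, $g\colon B\to B'$ with $g\circ\varphi_B=\varphi_{B'}\circ(f\otimes g)$. These form the category ${\sf HBrcd}$. $\overline{{\sf HBrcd}}^{\,\star}$ is the full subcategory of ${\sf HBrcd}$ of Hopf bracoids $(H,B,\varphi_B)$ such that $\varphi_B\colon H\otimes B\to B$ is a coalgebra morphism and $$(\Phi_{B}\otimes H)\circ(H\otimes c_{H,B})\circ((c_{H,H}\circ \delta_{H})\otimes B)=(\Phi_{B}\otimes H)\circ(H\otimes c_{H,B})\circ(\delta_{H}\otimes B).$$ For a Hopf algebra $X$, an algebra $A$ with a left $X$-module structure $\varphi_A$ is a left $X$-module algebra if $\varphi_A\circ(X\otimes\eta_A)=\varepsilon_X\otimes\eta_A$ and $\varphi_A\circ(X\otimes\mu_A)=\mu_A\circ(\varphi_A\otimes\varphi_A)\circ(X\otimes c_{X,A}\otimes A)\circ(\delta_X\otimes A\otimes A)$. A 1-cocycle in ${\sf C}$ consists of Hopf algebras $H,B$ in ${\sf C}$, a left $H$-module algebra structure $(B,\gamma_B)$, and a coalgebra morphism $\pi\colon H\to B$ such that $\mu_{B}\circ(\pi\otimes\gamma_{B})\circ(\delta_{H}\otimes\pi)=\pi\circ\mu_{H}$. A morphism of 1-cocycles from $\pi\colon H\to B$ to $\tau\colon H'\to B'$ is a pair $(f,g)$ of Hopf algebra morphisms $f\colon H\to H'$, $g\colon B\to B'$ with $\tau\circ f=g\circ\pi$ and $g\circ\gamma_B=\gamma_{B'}\circ(f\otimes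 g)$. These form the category ${\sf 1C}$. $\overline{{\sf 1C}}^{\,\star}$ is the full subcategory of ${\sf 1C}$ of 1-cocycles $\pi\colon H\to B$ such that $\gamma_B\colon H\otimes B\to B$ is a coalgebra morphism and $$(\gamma_{B}\otimes H)\circ(H\otimes c_{H,B})\circ((c_{H,H}\circ\delta_{H})\otimes B)=(\gamma_{B}\otimes H)\circ(H\otimes c_{H,B})\circ(\delta_{H}\otimes B).$$ *)

theory Defs
  imports Main
begin

section \<open>Categories, functors, isomorphism of categories\<close>

record ('o, 'm) category =
  Obj :: "'o set"
  Arr :: "'m set"
  Dom :: "'m \<Rightarrow> 'o"
  Cod :: "'m \<Rightarrow> 'o"
  Ident :: "'o \<Rightarrow> 'm"  ("\<one>\<index>")
  Comp :: "'m \<Rightarrow> 'm \<Rightarrow> 'm"  (infixl "\<cdot>\<index>" 55)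

definition Hom :: "('o, 'm, 'z) category_scheme \<Rightarrow> 'o \<Rightarrow> 'o \<Rightarrow> 'm set"  ("Hom\<index>")
  where "Hom\<^bsub>C\<^esub> X Y = {f \<in> Arr C. Dom C f = X \<and> Cod C f = Y}"

text \<open>In \<open>g \<cdot> f\<close>, the arrow applied first is \<open>f\<close>.\<close>

locale category =
  fixes C :: "('o, 'm, 'z) category_scheme"  (structure)
  assumes dom_obj: "f \<in> Arr C \<Longrightarrow> Dom C f \<in> Obj C"
    and cod_obj: "f \<in> Arr C \<Longrightarrow> Cod C f \<in> Obj C"
    and ident_hom: "X \<in> Obj C \<Longrightarrow> \<one> X \<in> Hom X X"
    and comp_hom: "\<lbrakk>f \<in> Hom X Y; g \<in> Hom Y Z\<rbrakk> \<Longrightarrow> g \<cdot> f \<in> Hom X Z"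
    and ident_left: "f \<in> Hom X Y \<Longrightarrow> \<one> Y \<cdot> f = f"
    and ident_right: "f \<in> Hom X Y \<Longrightarrow> f \<cdot> \<one> X = f"
    and comp_assoc: "\<lbrakk>f \<in> Hom W X; g \<in> Hom X Y; h \<in> Hom Y Z\<rbrakk> \<Longrightarrow> (h \<cdot> g) \<cdot> f = h \<cdot> (g \<cdot> f)"

definition iso_arrow :: "('o, 'm, 'z) category_scheme \<Rightarrow> 'o \<Rightarrow> 'o \<Rightarrow> 'm \<Rightarrow> bool"
  where "iso_arrow C X Y f \<longleftrightarrow> f \<in> Hom\<^bsub>C\<^esub> X Y \<and>
    (\<exists>g \<in> Hom\<^bsub>C\<^esub> Y X. g \<cdot>\<^bsub>C\<^esub> f = \<one>\<^bsub>C\<^esub> X \<and> f \<cdot>\<^bsub>C\<^esub> g = \<one>\<^bsub>C\<^esub> Y)"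

definition is_functor ::
    "('o, 'm, 'y) category_scheme \<Rightarrow> ('p, 'n, 'z) category_scheme \<Rightarrow> ('o \<Rightarrow> 'p) \<Rightarrow> ('m \<Rightarrow> 'n) \<Rightarrow> bool"
  where "is_functor C D Fo Fa \<longleftrightarrow> category C \<and> category D \<and>
    (\<forall>X \<in> Obj C. Fo X \<in> Obj D) \<and>
    (\<forall>X \<in> Obj C. \<forall>Y \<in> Obj C. \<forall>f \<in> Hom\<^bsub>C\<^esub> X Y. Fa f \<in> Hom\<^bsub>D\<^esub> (Fo X) (Fo Y)) \<and>
    (\<forall>X \<in> Obj C. Fa (\<one>\<^bsub>C\<^esub> X) = \<one>\<^bsub>D\<^esub> (Fo X)) \<and>
    (\<forall>X \<in> Obj C. \<forall>Y \<in> Obj C. \<forall>Z \<in> Obj C. \<forall>f \<in> Hom\<^bsub>C\<^esub> X Y. \<forall>g \<in> Hom\<^bsub>C\<^esub> Y Z.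
        Fa (g \<cdot>\<^bsub>C\<^esub> f) = Fa g \<cdot>\<^bsub>D\<^esub> Fa f)"

definition isomorphic_categories ::
    "('o, 'm, 'y) category_scheme \<Rightarrow> ('p, 'n, 'z) category_scheme \<Rightarrow> bool"
  where "isomorphic_categories C D \<longleftrightarrow>
    (\<exists>Fo Fa Go Ga. is_functor C D Fo Fa \<and> is_functor D C Go Ga \<and>
      (\<forall>X \<in> Obj C. Go (Fo X) = X) \<and> (\<forall>f \<in> Arr C. Ga (Fa f) = f) \<and>
      (\<forall>Y \<in> Obj D. Fo (Go Y) = Y) \<and> (\<forall>g \<in> Arr D. Fa (Ga g) = g))"

definition full_subcategory :: "('o, 'm) category \<Rightarrow> ('o \<Rightarrow> bool) \<Rightarrow> ('o, 'm) category"
  where "full_subcategory C P =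
    C\<lparr>Obj := {X \<in> Obj C. P X}, Arr := {f \<in> Arr C. P (Dom C f) \<and> P (Cod C f)}\<rparr>"

section \<open>Strict braided monoidal categories\<close>

record ('o, 'm) braided_category = "('o, 'm) category" +
  TensorO :: "'o \<Rightarrow> 'o \<Rightarrow> 'o"  (infixr "\<otimes>\<^sub>o\<index>" 70)
  TensorA :: "'m \<Rightarrow> 'm \<Rightarrow> 'm"  (infixr "\<otimes>\<index>" 70)
  UnitO :: 'o  ("K\<index>")
  Braid :: "'o \<Rightarrow> 'o \<Rightarrow> 'm"  ("\<c>\<index>")

text \<open>Strictness: the associativity and unit constraints are identities. Their naturality then
  says that the tensor product of arrows is strictly associative and unital as well.\<close>

locale strict_monoidal_category = category C
  for C :: "('o, 'm, 'z) braided_category_scheme"  (structure) +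
  assumes unit_obj: "K \<in> Obj C"
    and tensor_obj: "\<lbrakk>X \<in> Obj C; Y \<in> Obj C\<rbrakk> \<Longrightarrow> X \<otimes>\<^sub>o Y \<in> Obj C"
    and tensor_hom: "\<lbrakk>f \<in> Hom X X'; g \<in> Hom Y Y'\<rbrakk> \<Longrightarrow> f \<otimes> g \<in> Hom (X \<otimes>\<^sub>o Y) (X' \<otimes>\<^sub>o Y')"
    and tensor_ident: "\<lbrakk>X \<in> Obj C; Y \<in> Obj C\<rbrakk> \<Longrightarrow> \<one> X \<otimes> \<one> Y = \<one> (X \<otimes>\<^sub>o Y)"
    and interchange: "\<lbrakk>f \<in> Hom X X'; f' \<in> Hom X' X''; g \<in> Hom Y Y'; g' \<in> Hom Y' Y''\<rbrakk>
        \<Longrightarrow> (f' \<cdot> f) \<otimes> (g' \<cdot> g) = (f' \<otimes> g') \<cdot> (f \<otimes> g)"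
    and tensor_obj_assoc: "\<lbrakk>X \<in> Obj C; Y \<in> Obj C; Z \<in> Obj C\<rbrakk>
        \<Longrightarrow> (X \<otimes>\<^sub>o Y) \<otimes>\<^sub>o Z = X \<otimes>\<^sub>o (Y \<otimes>\<^sub>o Z)"
    and unit_tensor_obj: "X \<in> Obj C \<Longrightarrow> K \<otimes>\<^sub>o X = X"
    and tensor_unit_obj: "X \<in> Obj C \<Longrightarrow> X \<otimes>\<^sub>o K = X"
    and tensor_assoc: "\<lbrakk>f \<in> Arr C; g \<in> Arr C; h \<in> Arr C\<rbrakk> \<Longrightarrow> (f \<otimes> g) \<otimes> h = f \<otimes> (g \<otimes> h)"
    and unit_tensor: "f \<in> Arr C \<Longrightarrow> \<one> K \<otimes> f = f"
    and tensor_unit: "f \<in> Arr C \<Longrightarrow> f \<otimes> \<one> K = f"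

locale strict_braided_monoidal_category = strict_monoidal_category C
  for C :: "('o, 'm, 'z) braided_category_scheme"  (structure) +
  assumes braid_iso: "\<lbrakk>X \<in> Obj C; Y \<in> Obj C\<rbrakk>
        \<Longrightarrow> iso_arrow C (X \<otimes>\<^sub>o Y) (Y \<otimes>\<^sub>o X) (\<c> X Y)"
    and braid_natural: "\<lbrakk>f \<in> Hom X X'; g \<in> Hom Y Y'\<rbrakk>
        \<Longrightarrow> \<c> X' Y' \<cdot> (f \<otimes> g) = (g \<otimes> f) \<cdot> \<c> X Y"
    and hexagon1: "\<lbrakk>X \<in> Obj C; Y \<in> Obj C; Z \<in> Obj C\<rbrakk>
        \<Longrightarrow> \<c> X (Y \<otimes>\<^sub>o Z) = (\<one> Y \<otimes> \<c> X Z) \<cdot> (\<c> X Y \<otimes> \<one> Z)"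
    and hexagon2: "\<lbrakk>X \<in> Obj C; Y \<in> Obj C; Z \<in> Obj C\<rbrakk>
        \<Longrightarrow> \<c> (X \<otimes>\<^sub>o Y) Z = (\<c> X Z \<otimes> \<one> Y) \<cdot> (\<one> X \<otimes> \<c> Y Z)"

section \<open>Algebras, coalgebras and Hopf algebras\<close>

record ('o, 'm) algebra =
  alg_obj :: 'o
  alg_unit :: 'm
  alg_mult :: 'm

record ('o, 'm) coalgebra =
  coalg_obj :: 'o
  coalg_counit :: 'm
  coalg_comult :: 'm

record ('o, 'm) hopf =
  carr :: 'o
  eta :: 'm
  mu :: 'm
  eps :: 'm
  delta :: 'm
  lam :: 'm

definition alg_of :: "('o, 'm) hopf \<Rightarrow> ('o, 'm) algebra"
  where "alg_of X = \<lparr>alg_obj = carr X, alg_unit = eta X, alg_mult = mu X\<rparr>"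

definition coalg_of :: "('o, 'm) hopf \<Rightarrow> ('o, 'm) coalgebra"
  where "coalg_of X = \<lparr>coalg_obj = carr X, coalg_counit = eps X, coalg_comult = delta X\<rparr>"

definition is_algebra :: "('o, 'm, 'z) braided_category_scheme \<Rightarrow> ('o, 'm) algebra \<Rightarrow> bool"
  where "is_algebra C A \<longleftrightarrow> (let X = alg_obj A; \<eta> = alg_unit A; \<mu> = alg_mult A in
      X \<in> Obj C \<and> \<eta> \<in> Hom K X \<and> \<mu> \<in> Hom (X \<otimes>\<^sub>o X) X \<and>
      \<mu> \<cdot> (\<eta> \<otimes> \<one> X) = \<one> X \<and>
      \<mu> \<cdot> (\<one> X \<otimes> \<eta>) = \<one> X \<and>
      \<mu> \<cdot> (\<mu> \<otimes> \<one> X) = \<mu> \<cdot> (\<one> X \<otimes> \<mu>))"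
  for C (structure)

definition is_coalgebra :: "('o, 'm, 'z) braided_category_scheme \<Rightarrow> ('o, 'm) coalgebra \<Rightarrow> bool"
  where "is_coalgebra C D \<longleftrightarrow> (let X = coalg_obj D; \<epsilon> = coalg_counit D; \<delta> = coalg_comult D in
      X \<in> Obj C \<and> \<epsilon> \<in> Hom X K \<and> \<delta> \<in> Hom X (X \<otimes>\<^sub>o X) \<and>
      (\<epsilon> \<otimes> \<one> X) \<cdot> \<delta> = \<one> X \<and>
      (\<one> X \<otimes> \<epsilon>) \<cdot> \<delta> = \<one> X \<and>
      (\<delta> \<otimes> \<one> X) \<cdot> \<delta> = (\<one> X \<otimes> \<delta>) \<cdot> \<delta>)"
  for C (structure)

text \<open>The arrow \<open>\<one> K\<close> is also the multiplication of the unit algebra, since \<open>K \<otimes>\<^sub>o K = K\<close>.\<close>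

definition unit_algebra :: "('o, 'm, 'z) braided_category_scheme \<Rightarrow> ('o, 'm) algebra"
  where "unit_algebra C = \<lparr>alg_obj = K, alg_unit = \<one> K, alg_mult = \<one> K\<rparr>"
  for C (structure)

definition tensor_algebra ::
    "('o, 'm, 'z) braided_category_scheme \<Rightarrow> ('o, 'm) algebra \<Rightarrow> ('o, 'm) algebra \<Rightarrow> ('o, 'm) algebra"
  where "tensor_algebra C A B =
    \<lparr>alg_obj = alg_obj A \<otimes>\<^sub>o alg_obj B,
     alg_unit = alg_unit A \<otimes> alg_unit B,
     alg_mult = (alg_mult A \<otimes> alg_mult B)
        \<cdot> (\<one> (alg_obj A) \<otimes> \<c> (alg_obj B) (alg_obj A) \<otimes> \<one> (alg_obj B))\<rparr>"
  for C (structure)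

definition tensor_coalgebra ::
    "('o, 'm, 'z) braided_category_scheme \<Rightarrow> ('o, 'm) coalgebra \<Rightarrow> ('o, 'm) coalgebra
      \<Rightarrow> ('o, 'm) coalgebra"
  where "tensor_coalgebra C D E =
    \<lparr>coalg_obj = coalg_obj D \<otimes>\<^sub>o coalg_obj E,
     coalg_counit = coalg_counit D \<otimes> coalg_counit E,
     coalg_comult = (\<one> (coalg_obj D) \<otimes> \<c> (coalg_obj D) (coalg_obj E) \<otimes> \<one> (coalg_obj E))
        \<cdot> (coalg_comult D \<otimes> coalg_comult E)\<rparr>"
  for C (structure)

definition algebra_morphism ::
    "('o, 'm, 'z) braided_category_scheme \<Rightarrow> ('o, 'm) algebra \<Rightarrow> ('o, 'm) algebra \<Rightarrow> 'm \<Rightarrow> bool"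
  where "algebra_morphism C A B f \<longleftrightarrow>
      f \<in> Hom (alg_obj A) (alg_obj B) \<and>
      f \<cdot> alg_unit A = alg_unit B \<and>
      f \<cdot> alg_mult A = alg_mult B \<cdot> (f \<otimes> f)"
  for C (structure)

definition coalgebra_morphism ::
    "('o, 'm, 'z) braided_category_scheme \<Rightarrow> ('o, 'm) coalgebra \<Rightarrow> ('o, 'm) coalgebra \<Rightarrow> 'm \<Rightarrow> bool"
  where "coalgebra_morphism C D E f \<longleftrightarrow>
      f \<in> Hom (coalg_obj D) (coalg_obj E) \<and>
      coalg_counit E \<cdot> f = coalg_counit D \<and>
      coalg_comult E \<cdot> f = (f \<otimes> f) \<cdot> coalg_comult D"
  for C (structure)

definition hopf_algebra :: "('o, 'm, 'z) braided_category_scheme \<Rightarrow> ('o, 'm) hopf \<Rightarrow> bool"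
  where "hopf_algebra C X \<longleftrightarrow>
      is_algebra C (alg_of X) \<and> is_coalgebra C (coalg_of X) \<and>
      algebra_morphism C (alg_of X) (unit_algebra C) (eps X) \<and>
      algebra_morphism C (alg_of X) (tensor_algebra C (alg_of X) (alg_of X)) (delta X) \<and>
      lam X \<in> Hom (carr X) (carr X) \<and>
      mu X \<cdot> (lam X \<otimes> \<one> (carr X)) \<cdot> delta X = eta X \<cdot> eps X \<and>
      mu X \<cdot> (\<one> (carr X) \<otimes> lam X) \<cdot> delta X = eta X \<cdot> eps X"
  for C (structure)

definition hopf_morphism ::
    "('o, 'm, 'z) braided_category_scheme \<Rightarrow> ('o, 'm) hopf \<Rightarrow> ('o, 'm) hopf \<Rightarrow> 'm \<Rightarrow> bool"
  where "hopf_morphism C X Y f \<longleftrightarrow>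
      algebra_morphism C (alg_of X) (alg_of Y) f \<and> coalgebra_morphism C (coalg_of X) (coalg_of Y) f"

section \<open>Modules and module algebras\<close>

definition left_module ::
    "('o, 'm, 'z) braided_category_scheme \<Rightarrow> ('o, 'm) hopf \<Rightarrow> 'o \<Rightarrow> 'm \<Rightarrow> bool"
  where "left_module C X M \<phi> \<longleftrightarrow>
      M \<in> Obj C \<and> \<phi> \<in> Hom (carr X \<otimes>\<^sub>o M) M \<and>
      \<phi> \<cdot> (eta X \<otimes> \<one> M) = \<one> M \<and>
      \<phi> \<cdot> (\<one> (carr X) \<otimes> \<phi>) = \<phi> \<cdot> (mu X \<otimes> \<one> M)"
  for C (structure)

definition left_module_algebra ::
    "('o, 'm, 'z) braided_category_scheme \<Rightarrow> ('o, 'm) hopf \<Rightarrow> ('o, 'm) algebra \<Rightarrow> 'm \<Rightarrow> bool"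
  where "left_module_algebra C X A \<phi> \<longleftrightarrow>
      is_algebra C A \<and> left_module C X (alg_obj A) \<phi> \<and>
      \<phi> \<cdot> (\<one> (carr X) \<otimes> alg_unit A) = eps X \<otimes> alg_unit A \<and>
      \<phi> \<cdot> (\<one> (carr X) \<otimes> alg_mult A) =
        alg_mult A \<cdot> (\<phi> \<otimes> \<phi>) \<cdot> (\<one> (carr X) \<otimes> \<c> (carr X) (alg_obj A) \<otimes> \<one> (alg_obj A))
          \<cdot> (delta X \<otimes> \<one> (alg_obj A) \<otimes> \<one> (alg_obj A))"
  for C (structure)

text \<open>The compatibility required of the objects of both full subcategories, for an arrow
  \<open>\<psi> : H \<otimes> B \<rightarrow> B\<close>; it is imposed on \<open>\<Phi>\<^sub>B\<close> for Hopf bracoids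
  and on \<open>\<gamma>\<^sub>B\<close> for 1-cocycles.\<close>

definition star_condition ::
    "('o, 'm, 'z) braided_category_scheme \<Rightarrow> ('o, 'm) hopf \<Rightarrow> ('o, 'm) hopf \<Rightarrow> 'm \<Rightarrow> bool"
  where "star_condition C H B \<psi> \<longleftrightarrow>
      (\<psi> \<otimes> \<one> (carr H)) \<cdot> (\<one> (carr H) \<otimes> \<c> (carr H) (carr B))
          \<cdot> ((\<c> (carr H) (carr H) \<cdot> delta H) \<otimes> \<one> (carr B))
      = (\<psi> \<otimes> \<one> (carr H)) \<cdot> (\<one> (carr H) \<otimes> \<c> (carr H) (carr B))
          \<cdot> (delta H \<otimes> \<one> (carr B))"
  for C (structure)

text \<open>Objects \<open>x\<close> come with two Hopf algebras \<open>hH x\<close> and \<open>hB x\<close>; an arrow \<open>(x, y, f, g)\<close> from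
  \<open>x\<close> to \<open>y\<close> is a pair of arrows \<open>f : hH x \<rightarrow> hH y\<close>, \<open>g : hB x \<rightarrow> hB y\<close>
  satisfying \<open>M x y f g\<close>, and records its source and target.\<close>

definition hopf_pair_category ::
    "('o, 'm, 'z) braided_category_scheme \<Rightarrow> ('x \<Rightarrow> ('o, 'm) hopf) \<Rightarrow> ('x \<Rightarrow> ('o, 'm) hopf)
      \<Rightarrow> ('x \<Rightarrow> bool) \<Rightarrow> ('x \<Rightarrow> 'x \<Rightarrow> 'm \<Rightarrow> 'm \<Rightarrow> bool) \<Rightarrow> ('x, 'x \<times> 'x \<times> 'm \<times> 'm) category"
  where "hopf_pair_category C hH hB P M =
    \<lparr>Obj = {x. P x},
     Arr = {(x, y, f, g). P x \<and> P y \<and> M x y f g},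
     Dom = (\<lambda>(x, y, f, g). x),
     Cod = (\<lambda>(x, y, f, g). y),
     Ident = (\<lambda>x. (x, x, \<one> (carr (hH x)), \<one> (carr (hB x)))),
     Comp = (\<lambda>(y', z, f', g') (x, y, f, g). (x, z, f' \<cdot> f, g' \<cdot> g))\<rparr>"
  for C (structure)

section \<open>Hopf bracoids\<close>

record ('o, 'm) bracoid =
  br_H :: "('o, 'm) hopf"
  br_B :: "('o, 'm) hopf"
  br_phi :: 'm

definition bracoid_u :: "('o, 'm, 'z) braided_category_scheme \<Rightarrow> ('o, 'm) bracoid \<Rightarrow> 'm"
  where "bracoid_u C x = br_phi x \<cdot> (\<one> (carr (br_H x)) \<otimes> eta (br_B x))"
  for C (structure)

definition bracoid_Phi :: "('o, 'm, 'z) braided_category_scheme \<Rightarrow> ('o, 'm) bracoid \<Rightarrow> 'm"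
  where "bracoid_Phi C x =
      mu (br_B x) \<cdot> ((lam (br_B x) \<cdot> bracoid_u C x) \<otimes> br_phi x)
        \<cdot> (delta (br_H x) \<otimes> \<one> (carr (br_B x)))"
  for C (structure)

definition hopf_bracoid :: "('o, 'm, 'z) braided_category_scheme \<Rightarrow> ('o, 'm) bracoid \<Rightarrow> bool"
  where "hopf_bracoid C x \<longleftrightarrow> (let H = br_H x; B = br_B x; \<phi> = br_phi x in
      hopf_algebra C H \<and> hopf_algebra C B \<and> left_module C H (carr B) \<phi> \<and>
      \<phi> \<cdot> (\<one> (carr H) \<otimes> mu B) =
        mu B \<cdot> (\<phi> \<otimes> bracoid_Phi C x) \<cdot> (\<one> (carr H) \<otimes> \<c> (carr H) (carr B) \<otimes> \<one> (carr B))
          \<cdot> (delta H \<otimes> \<one> (carr B) \<otimes> \<one> (carr B)))"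
  for C (structure)

definition bracoid_morphism ::
    "('o, 'm, 'z) braided_category_scheme \<Rightarrow> ('o, 'm) bracoid \<Rightarrow> ('o, 'm) bracoid \<Rightarrow> 'm \<Rightarrow> 'm \<Rightarrow> bool"
  where "bracoid_morphism C x y f g \<longleftrightarrow>
      hopf_morphism C (br_H x) (br_H y) f \<and> hopf_morphism C (br_B x) (br_B y) g \<and>
      g \<cdot> br_phi x = br_phi y \<cdot> (f \<otimes> g)"
  for C (structure)

definition HBrcd :: "('o, 'm, 'z) braided_category_scheme \<Rightarrow>
    (('o, 'm) bracoid, ('o, 'm) bracoid \<times> ('o, 'm) bracoid \<times> 'm \<times> 'm) category"
  where "HBrcd C = hopf_pair_category C br_H br_B (hopf_bracoid C) (bracoid_morphism C)"

definition HBrcd_star :: "('o, 'm, 'z) braided_category_scheme \<Rightarrow>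
    (('o, 'm) bracoid, ('o, 'm) bracoid \<times> ('o, 'm) bracoid \<times> 'm \<times> 'm) category"
  where "HBrcd_star C = full_subcategory (HBrcd C) (\<lambda>x.
      coalgebra_morphism C (tensor_coalgebra C (coalg_of (br_H x)) (coalg_of (br_B x)))
        (coalg_of (br_B x)) (br_phi x) \<and>
      star_condition C (br_H x) (br_B x) (bracoid_Phi C x))"

section \<open>1-cocycles\<close>

record ('o, 'm) cocycle =
  cc_H :: "('o, 'm) hopf"
  cc_B :: "('o, 'm) hopf"
  cc_gamma :: 'm
  cc_pi :: 'm

definition one_cocycle :: "('o, 'm, 'z) braided_category_scheme \<Rightarrow> ('o, 'm) cocycle \<Rightarrow> bool"
  where "one_cocycle C x \<longleftrightarrow> (let H = cc_H x; B = cc_B x; \<gamma> = cc_gamma x; \<pi> = cc_pi x in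
      hopf_algebra C H \<and> hopf_algebra C B \<and> left_module_algebra C H (alg_of B) \<gamma> \<and>
      coalgebra_morphism C (coalg_of H) (coalg_of B) \<pi> \<and>
      mu B \<cdot> (\<pi> \<otimes> \<gamma>) \<cdot> (delta H \<otimes> \<pi>) = \<pi> \<cdot> mu H)"
  for C (structure)

definition cocycle_morphism ::
    "('o, 'm, 'z) braided_category_scheme \<Rightarrow> ('o, 'm) cocycle \<Rightarrow> ('o, 'm) cocycle \<Rightarrow> 'm \<Rightarrow> 'm \<Rightarrow> bool"
  where "cocycle_morphism C x y f g \<longleftrightarrow>
      hopf_morphism C (cc_H x) (cc_H y) f \<and> hopf_morphism C (cc_B x) (cc_B y) g \<and>
      cc_pi y \<cdot> f = g \<cdot> cc_pi x \<and>
      g \<cdot> cc_gamma x = cc_gamma y \<cdot> (f \<otimes> g)"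
  for C (structure)

definition OneC :: "('o, 'm, 'z) braided_category_scheme \<Rightarrow>
    (('o, 'm) cocycle, ('o, 'm) cocycle \<times> ('o, 'm) cocycle \<times> 'm \<times> 'm) category"
  where "OneC C = hopf_pair_category C cc_H cc_B (one_cocycle C) (cocycle_morphism C)"

definition OneC_star :: "('o, 'm, 'z) braided_category_scheme \<Rightarrow>
    (('o, 'm) cocycle, ('o, 'm) cocycle \<times> ('o, 'm) cocycle \<times> 'm \<times> 'm) category"
  where "OneC_star C = full_subcategory (OneC C) (\<lambda>x.
      coalgebra_morphism C (tensor_coalgebra C (coalg_of (cc_H x)) (coalg_of (cc_B x)))
        (coalg_of (cc_B x)) (cc_gamma x) \<and>
      star_condition C (cc_H x) (cc_B x) (cc_gamma x))"

end

theory Submission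
  imports Defs
begin

text \<open>
  For a coalgebra \<open>D\<close> and an algebra \<open>A\<close>, arrows \<open>f : D \<otimes> M \<rightarrow> A\<close> and \<open>g : D \<otimes> N \<rightarrow> A\<close>
  have a convolution \<open>f \<star> g : D \<otimes> M \<otimes> N \<rightarrow> A\<close>, which is associative. A coalgebra morphism
  \<open>p : D \<rightarrow> B\<close> into a Hopf algebra has the convolution inverse \<open>\<lambda>\<^sub>B p\<close>, so it can be cancelled on
  the left; if \<open>w : B \<rightarrow> A\<close> is an algebra morphism, so can \<open>w p\<close>.

  The isomorphism sends \<open>(\<pi>, \<gamma>)\<close> to \<open>\<phi> = \<pi> \<star> \<gamma>\<close>, and its inverse sends \<open>\<phi>\<close> to
  \<open>(u\<^sub>\<phi>, \<Phi>)\<close>, where \<open>\<Phi> = \<lambda>\<^sub>B u\<^sub>\<phi> \<star> \<phi>\<close>. Each axiom on \<open>\<phi>\<close> is an axiom on \<open>\<gamma>\<close> convolved on the left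
  with a cancellable arrow: with \<open>\<pi>\<close> for the multiplicativity of the action, with
  \<open>\<pi> \<mu>\<^sub>H : H \<otimes> H \<rightarrow> B\<close> for the associativity of the action, and with
  \<open>\<delta>\<^sub>B \<pi> : H \<rightarrow> B \<otimes> B\<close> for the comultiplicativity. So the axioms for \<open>\<phi>\<close> and for
  \<open>(\<pi>, \<gamma>)\<close> are equivalent.
\<close>

section \<open>Calculus of arrows\<close>

context category
begin

lemma Hom_iff: "f \<in> Hom X Y \<longleftrightarrow> f \<in> Arr C \<and> Dom C f = X \<and> Cod C f = Y"
  by (simp add: Hom_def)

lemma Ident_simps [simp]:
  assumes "X \<in> Obj C"
  shows "\<one> X \<in> Arr C" "Dom C (\<one> X) = X" "Cod C (\<one> X) = X"
  using ident_hom[OF assms] by (simp_all add: Hom_iff)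

text \<open>The axioms are stated with \<open>Hom X Y\<close>, whose object variables need not occur
  in the conclusions. Phrased with \<open>Arr\<close>, \<open>Dom\<close> and \<open>Cod\<close>,
  the typing of a composite becomes a computation for the simplifier.\<close>

lemma Comp_simps [simp]:
  assumes "f \<in> Arr C" "g \<in> Arr C" "Dom C g = Cod C f"
  shows "g \<cdot> f \<in> Arr C" "Dom C (g \<cdot> f) = Dom C f" "Cod C (g \<cdot> f) = Cod C g"
  using comp_hom[of f "Dom C f" "Cod C f" g "Cod C g"] assms by (simp_all add: Hom_iff)

lemma Ident_Comp [simp]: "f \<in> Arr C \<Longrightarrow> Cod C f = X \<Longrightarrow> \<one> X \<cdot> f = f"
  using ident_left[of f "Dom C f" X] by (simp add: Hom_iff)

lemma Comp_Ident [simp]: "f \<in> Arr C \<Longrightarrow> Dom C f = X \<Longrightarrow> f \<cdot> \<one> X = f"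
  using ident_right[of f X "Cod C f"] by (simp add: Hom_iff)

lemma Comp_assoc:
  assumes "f \<in> Arr C" "g \<in> Arr C" "h \<in> Arr C" "Dom C g = Cod C f" "Dom C h = Cod C g"
  shows "(h \<cdot> g) \<cdot> f = h \<cdot> (g \<cdot> f)"
  using comp_assoc[of f "Dom C f" "Cod C f" g "Cod C g" h "Cod C h"] assms by (simp add: Hom_iff)

declare dom_obj [simp] cod_obj [simp]

end

context strict_monoidal_category
begin

declare unit_obj [simp] tensor_obj [simp] unit_tensor_obj [simp] tensor_unit_obj [simp]
  tensor_obj_assoc [simp] unit_tensor [simp] tensor_unit [simp] tensor_assoc [simp]

lemma Tensor_simps [simp]:
  assumes "f \<in> Arr C" "g \<in> Arr C"
  shows "f \<otimes> g \<in> Arr C" "Dom C (f \<otimes> g) = Dom C f \<otimes>\<^sub>o Dom C g"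
    "Cod C (f \<otimes> g) = Cod C f \<otimes>\<^sub>o Cod C g"
  using tensor_hom[of f "Dom C f" "Cod C f" g "Dom C g" "Cod C g"] assms by (simp_all add: Hom_iff)

text \<open>Oriented against \<open>tensor_ident\<close>: identities on products are split, so that
  composites of flat tensor products can be compared factor by factor.\<close>

lemma Tensor_Ident: "\<lbrakk>X \<in> Obj C; Y \<in> Obj C\<rbrakk> \<Longrightarrow> \<one> (X \<otimes>\<^sub>o Y) = \<one> X \<otimes> \<one> Y"
  by (simp add: tensor_ident)

text \<open>Once an identity on a product has been split, \<open>Ident_Comp\<close> no longer
  matches it.\<close>

lemma Ident_Ident_Comp [simp]:
  "\<lbrakk>X \<in> Obj C; Y \<in> Obj C; f \<in> Arr C; Cod C f = X \<otimes>\<^sub>o Y\<rbrakk> \<Longrightarrow> (\<one> X \<otimes> \<one> Y) \<cdot> f = f"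
  by (simp add: tensor_ident)

lemma Comp_Ident_Ident [simp]:
  "\<lbrakk>X \<in> Obj C; Y \<in> Obj C; f \<in> Arr C; Dom C f = X \<otimes>\<^sub>o Y\<rbrakk> \<Longrightarrow> f \<cdot> (\<one> X \<otimes> \<one> Y) = f"
  by (simp add: tensor_ident)

lemma Interchange:
  assumes "f \<in> Arr C" "f' \<in> Arr C" "g \<in> Arr C" "g' \<in> Arr C" "Dom C f' = Cod C f" "Dom C g' = Cod C g"
  shows "(f' \<otimes> g') \<cdot> (f \<otimes> g) = (f' \<cdot> f) \<otimes> (g' \<cdot> g)"
  using interchange[of f "Dom C f" "Cod C f" f' "Cod C f'" g "Dom C g" "Cod C g" g' "Cod C g'"] assms
  by (simp add: Hom_iff)

text \<open>Composites are usually nested to the right, where \<open>Interchange\<close> alone does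
  not see two adjacent tensor products.\<close>

lemma Interchange_Comp:
  assumes "f \<in> Arr C" "f' \<in> Arr C" "g \<in> Arr C" "g' \<in> Arr C" "h \<in> Arr C"
    "Dom C f' = Cod C f" "Dom C g' = Cod C g" "Cod C h = Dom C f \<otimes>\<^sub>o Dom C g"
  shows "(f' \<otimes> g') \<cdot> ((f \<otimes> g) \<cdot> h) = ((f' \<cdot> f) \<otimes> (g' \<cdot> g)) \<cdot> h"
  using assms by (simp add: Interchange flip: Comp_assoc)

end

section \<open>Typing and unit laws for the braiding, algebras and coalgebras\<close>

context strict_braided_monoidal_category
begin

lemma Braid_simps [simp]:
  assumes "X \<in> Obj C" "Y \<in> Obj C"
  shows "\<c> X Y \<in> Arr C" "Dom C (\<c> X Y) = X \<otimes>\<^sub>o Y" "Cod C (\<c> X Y) = Y \<otimes>\<^sub>o X"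
  using braid_iso[OF assms] by (simp_all add: iso_arrow_def Hom_iff)

lemma Braid_natural:
  assumes "f \<in> Arr C" "g \<in> Arr C" "Cod C f = X" "Cod C g = Y"
  shows "\<c> X Y \<cdot> (f \<otimes> g) = (g \<otimes> f) \<cdot> \<c> (Dom C f) (Dom C g)"
  using braid_natural[of f "Dom C f" X g "Dom C g" Y] assms by (simp add: Hom_iff)

lemma idempotent_iso:
  assumes "iso_arrow C X X f" "f \<cdot> f = f"
  shows "f = \<one> X"
proof -
  obtain g where f: "f \<in> Hom X X" and g: "g \<in> Hom X X" and gf: "g \<cdot> f = \<one> X"
    using assms(1) by (auto simp: iso_arrow_def)
  have "f = (g \<cdot> f) \<cdot> f" using f gf by (simp add: Hom_iff)
  also have "\<dots> = g \<cdot> (f \<cdot> f)" using f g by (simp add: Hom_iff Comp_assoc)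
  finally show ?thesis using assms(2) gf by simp
qed

text \<open>With two unit objects the hexagons say that these braidings are idempotent, and an
  idempotent isomorphism is an identity.\<close>

lemma Braid_unit [simp]:
  assumes "X \<in> Obj C"
  shows "\<c> X K = \<one> X" "\<c> K X = \<one> X"
proof -
  show "\<c> X K = \<one> X"
    using hexagon1[of X K K] braid_iso[of X K] assms by (intro idempotent_iso) simp_all
  show "\<c> K X = \<one> X"
    using hexagon2[of K K X] braid_iso[of K X] assms by (intro idempotent_iso) simp_all
qed

lemma coalgebra_simps [simp]:
  assumes "is_coalgebra C D"
  shows "coalg_obj D \<in> Obj C" "coalg_counit D \<in> Arr C" "Dom C (coalg_counit D) = coalg_obj D"
    "Cod C (coalg_counit D) = K" "coalg_comult D \<in> Arr C" "Dom C (coalg_comult D) = coalg_obj D"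
    "Cod C (coalg_comult D) = coalg_obj D \<otimes>\<^sub>o coalg_obj D"
  using assms by (simp_all add: is_coalgebra_def Let_def Hom_iff)

lemma algebra_simps [simp]:
  assumes "is_algebra C A"
  shows "alg_obj A \<in> Obj C" "alg_unit A \<in> Arr C" "Dom C (alg_unit A) = K"
    "Cod C (alg_unit A) = alg_obj A" "alg_mult A \<in> Arr C"
    "Dom C (alg_mult A) = alg_obj A \<otimes>\<^sub>o alg_obj A" "Cod C (alg_mult A) = alg_obj A"
  using assms by (simp_all add: is_algebra_def Let_def Hom_iff)

lemma mult_unit:
  assumes A: "is_algebra C A" and [simp]: "f \<in> Arr C" "Cod C f = alg_obj A"
  shows "alg_mult A \<cdot> (alg_unit A \<otimes> f) = f" "alg_mult A \<cdot> (f \<otimes> alg_unit A) = f"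
proof -
  note [simp] = algebra_simps[OF A]
  \<comment> \<open>By strictness \<open>f\<close> is \<open>\<one> K \<otimes> f\<close>, so the
    tensor product splits by interchange. The same trick is at work below wherever
    \<open>\<one> K\<close> is passed to \<open>Interchange\<close>.\<close>
  have "alg_unit A \<otimes> f = (alg_unit A \<otimes> \<one> (alg_obj A)) \<cdot> f"
    using Interchange[of "\<one> K" "alg_unit A" f "\<one> (alg_obj A)"] by simp
  then show "alg_mult A \<cdot> (alg_unit A \<otimes> f) = f"
    using A by (simp add: is_algebra_def Let_def flip: Comp_assoc)
  have "f \<otimes> alg_unit A = (\<one> (alg_obj A) \<otimes> alg_unit A) \<cdot> f"
    using Interchange[of f "\<one> (alg_obj A)" "\<one> K" "alg_unit A"] by simp
  then show "alg_mult A \<cdot> (f \<otimes> alg_unit A) = f"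
    using A by (simp add: is_algebra_def Let_def flip: Comp_assoc)
qed

section \<open>Twisted comultiplication and convolution\<close>

text \<open>In Sweedler notation, up to the braiding: \<open>d \<otimes> m\<close> goes to
  \<open>d1 \<otimes> m \<otimes> d2\<close>, the second copy crossing \<open>M\<close>. This
  composite is common to the star condition, the comultiplication of a tensor product and the module
  algebra axiom.\<close>

definition twist :: "('o, 'm) coalgebra \<Rightarrow> 'o \<Rightarrow> 'm"
  where "twist D M = (\<one> (coalg_obj D) \<otimes> \<c> (coalg_obj D) M) \<cdot> (coalg_comult D \<otimes> \<one> M)"

lemma twist_simps [simp]:
  assumes "is_coalgebra C D" "M \<in> Obj C"
  shows "twist D M \<in> Arr C" "Dom C (twist D M) = coalg_obj D \<otimes>\<^sub>o M"
    "Cod C (twist D M) = coalg_obj D \<otimes>\<^sub>o M \<otimes>\<^sub>o coalg_obj D"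
  using assms by (simp_all add: twist_def)

lemma twist_unit: "is_coalgebra C D \<Longrightarrow> twist D K = coalg_comult D"
  by (simp add: twist_def flip: Tensor_Ident)

text \<open>By the first hexagon the second copy of \<open>D\<close> may cross \<open>M\<close>
  first and \<open>N\<close> afterwards.\<close>

lemma twist_tensor:
  assumes D: "is_coalgebra C D" and [simp]: "M \<in> Obj C" "N \<in> Obj C"
  shows "twist D (M \<otimes>\<^sub>o N) = (\<one> (coalg_obj D \<otimes>\<^sub>o M) \<otimes> \<c> (coalg_obj D) N) \<cdot> (twist D M \<otimes> \<one> N)"
proof -
  let ?X = "coalg_obj D" let ?d = "coalg_comult D"
  note [simp] = coalgebra_simps[OF D]
  have "twist D (M \<otimes>\<^sub>o N)
      = (\<one> ?X \<otimes> ((\<one> M \<otimes> \<c> ?X N) \<cdot> (\<c> ?X M \<otimes> \<one> N))) \<cdot> (?d \<otimes> \<one> M \<otimes> \<one> N)"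
    by (simp add: twist_def hexagon1 Tensor_Ident)
  also have "\<dots> = ((\<one> ?X \<otimes> \<one> M \<otimes> \<c> ?X N) \<cdot> (\<one> ?X \<otimes> \<c> ?X M \<otimes> \<one> N)) \<cdot> (?d \<otimes> \<one> M \<otimes> \<one> N)"
    by (simp add: Interchange)
  also have "\<dots> = (\<one> ?X \<otimes> \<one> M \<otimes> \<c> ?X N) \<cdot> (((\<one> ?X \<otimes> \<c> ?X M) \<otimes> \<one> N) \<cdot> ((?d \<otimes> \<one> M) \<otimes> \<one> N))"
    by (simp add: Comp_assoc)
  also have "\<dots> = (\<one> ?X \<otimes> \<one> M \<otimes> \<c> ?X N) \<cdot> (twist D M \<otimes> \<one> N)"
    by (subst Interchange) (simp_all add: twist_def)
  finally show ?thesis by (simp add: Tensor_Ident)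
qed

text \<open>Comultiplicativity of \<open>k\<close> for the copied factor, naturality of the braiding
  for the factor that is crossed.\<close>

lemma twist_natural:
  assumes D: "is_coalgebra C D" and D': "is_coalgebra C D'" and k: "coalgebra_morphism C D D' k"
    and [simp]: "m \<in> Arr C"
  shows "twist D' (Cod C m) \<cdot> (k \<otimes> m) = (k \<otimes> m \<otimes> k) \<cdot> twist D (Dom C m)"
proof -
  let ?X = "coalg_obj D" let ?d = "coalg_comult D" let ?X' = "coalg_obj D'" let ?d' = "coalg_comult D'"
  note [simp] = coalgebra_simps[OF D] coalgebra_simps[OF D']
  have [simp]: "k \<in> Arr C" "Dom C k = ?X" "Cod C k = ?X'" and kd: "?d' \<cdot> k = (k \<otimes> k) \<cdot> ?d"
    using k by (simp_all add: coalgebra_morphism_def Hom_iff)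
  have "twist D' (Cod C m) \<cdot> (k \<otimes> m) = (\<one> ?X' \<otimes> \<c> ?X' (Cod C m)) \<cdot> ((?d' \<cdot> k) \<otimes> m)"
    by (simp add: twist_def Comp_assoc Interchange)
  also have "\<dots> = (\<one> ?X' \<otimes> \<c> ?X' (Cod C m)) \<cdot> ((k \<otimes> (k \<otimes> m)) \<cdot> (?d \<otimes> \<one> (Dom C m)))"
    using Interchange[of ?d "k \<otimes> k" "\<one> (Dom C m)" m] by (simp add: kd)
  also have "\<dots> = (k \<otimes> (\<c> ?X' (Cod C m) \<cdot> (k \<otimes> m))) \<cdot> (?d \<otimes> \<one> (Dom C m))"
    by (simp add: Interchange_Comp)
  also have "\<dots> = (k \<otimes> ((m \<otimes> k) \<cdot> \<c> ?X (Dom C m))) \<cdot> (?d \<otimes> \<one> (Dom C m))"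
    by (simp add: Braid_natural)
  also have "\<dots> = (k \<otimes> m \<otimes> k) \<cdot> twist D (Dom C m)"
    by (simp add: twist_def Interchange_Comp)
  finally show ?thesis .
qed

lemma twist_natural_right:
  assumes D: "is_coalgebra C D" and m: "m \<in> Arr C"
  shows "twist D (Cod C m) \<cdot> (\<one> (coalg_obj D) \<otimes> m)
    = (\<one> (coalg_obj D) \<otimes> m \<otimes> \<one> (coalg_obj D)) \<cdot> twist D (Dom C m)"
  using assms
  by (intro twist_natural[OF D D _ m])
    (simp add: coalgebra_morphism_def Hom_iff flip: Tensor_Ident)

text \<open>The two crossings of \<open>M\<close> merge into one crossing by
  \<open>D \<otimes> D\<close> (second hexagon). Coassociativity then moves the second copying to
  the crossing copy, and naturality moves it past \<open>M\<close>.\<close>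

lemma twist_coassoc:
  assumes D: "is_coalgebra C D" and [simp]: "M \<in> Obj C"
  shows "(twist D M \<otimes> \<one> (coalg_obj D)) \<cdot> twist D M
    = (\<one> (coalg_obj D \<otimes>\<^sub>o M) \<otimes> coalg_comult D) \<cdot> twist D M"
proof -
  let ?X = "coalg_obj D" let ?d = "coalg_comult D"
  note [simp] = coalgebra_simps[OF D]
  have co: "(?d \<otimes> \<one> ?X) \<cdot> ?d = (\<one> ?X \<otimes> ?d) \<cdot> ?d"
    using D by (simp add: is_coalgebra_def Let_def)
  have "(twist D M \<otimes> \<one> ?X) \<cdot> twist D M
      = (\<one> ?X \<otimes> \<c> ?X M \<otimes> \<one> ?X) \<cdot> ((?d \<otimes> \<one> (M \<otimes>\<^sub>o ?X)) \<cdot> (\<one> ?X \<otimes> \<c> ?X M)) \<cdot> (?d \<otimes> \<one> M)"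
  proof -
    have "twist D M \<otimes> \<one> ?X = (\<one> ?X \<otimes> \<c> ?X M \<otimes> \<one> ?X) \<cdot> (?d \<otimes> \<one> (M \<otimes>\<^sub>o ?X))"
      using Interchange[of "?d \<otimes> \<one> M" "\<one> ?X \<otimes> \<c> ?X M" "\<one> ?X" "\<one> ?X"]
      by (simp add: twist_def Tensor_Ident)
    then show ?thesis by (simp add: twist_def Comp_assoc)
  qed
  also have "(?d \<otimes> \<one> (M \<otimes>\<^sub>o ?X)) \<cdot> (\<one> ?X \<otimes> \<c> ?X M)
      = (\<one> (?X \<otimes>\<^sub>o ?X) \<otimes> \<c> ?X M) \<cdot> (?d \<otimes> \<one> (?X \<otimes>\<^sub>o M))"
    by (simp add: Interchange)
  also have "(\<one> ?X \<otimes> \<c> ?X M \<otimes> \<one> ?X) \<cdot> ((\<one> (?X \<otimes>\<^sub>o ?X) \<otimes> \<c> ?X M) \<cdot> (?d \<otimes> \<one> (?X \<otimes>\<^sub>o M))) \<cdot> (?d \<otimes> \<one> M)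
     = (\<one> ?X \<otimes> ((\<c> ?X M \<otimes> \<one> ?X) \<cdot> (\<one> ?X \<otimes> \<c> ?X M))) \<cdot> (((?d \<otimes> \<one> ?X) \<cdot> ?d) \<otimes> \<one> M)"
  proof -
    have "(?d \<otimes> \<one> (?X \<otimes>\<^sub>o M)) \<cdot> (?d \<otimes> \<one> M) = ((?d \<otimes> \<one> ?X) \<cdot> ?d) \<otimes> \<one> M"
      using Interchange[of ?d "?d \<otimes> \<one> ?X" "\<one> M" "\<one> M"] by (simp add: Tensor_Ident)
    moreover have "\<one> ?X \<otimes> ((\<c> ?X M \<otimes> \<one> ?X) \<cdot> (\<one> ?X \<otimes> \<c> ?X M))
       = (\<one> ?X \<otimes> \<c> ?X M \<otimes> \<one> ?X) \<cdot> (\<one> (?X \<otimes>\<^sub>o ?X) \<otimes> \<c> ?X M)"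
      by (simp add: Tensor_Ident Interchange)
    ultimately show ?thesis by (simp add: Comp_assoc)
  qed
  also have "(\<c> ?X M \<otimes> \<one> ?X) \<cdot> (\<one> ?X \<otimes> \<c> ?X M) = \<c> (?X \<otimes>\<^sub>o ?X) M"
    by (simp add: hexagon2)
  also have "((?d \<otimes> \<one> ?X) \<cdot> ?d) \<otimes> \<one> M = (\<one> ?X \<otimes> ?d \<otimes> \<one> M) \<cdot> (?d \<otimes> \<one> M)"
    unfolding co using Interchange[of ?d "\<one> ?X \<otimes> ?d" "\<one> M" "\<one> M"] by simp
  also have "(\<one> ?X \<otimes> \<c> (?X \<otimes>\<^sub>o ?X) M) \<cdot> ((\<one> ?X \<otimes> ?d \<otimes> \<one> M) \<cdot> (?d \<otimes> \<one> M))
     = (\<one> ?X \<otimes> (\<c> (?X \<otimes>\<^sub>o ?X) M \<cdot> (?d \<otimes> \<one> M))) \<cdot> (?d \<otimes> \<one> M)"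
    by (simp add: Interchange_Comp)
  also have "\<c> (?X \<otimes>\<^sub>o ?X) M \<cdot> (?d \<otimes> \<one> M) = (\<one> M \<otimes> ?d) \<cdot> \<c> ?X M"
    by (simp add: Braid_natural)
  also have "(\<one> ?X \<otimes> ((\<one> M \<otimes> ?d) \<cdot> \<c> ?X M)) \<cdot> (?d \<otimes> \<one> M) = (\<one> (?X \<otimes>\<^sub>o M) \<otimes> ?d) \<cdot> twist D M"
    by (simp add: twist_def Interchange_Comp Tensor_Ident)
  finally show ?thesis .
qed


lemma twist_counit:
  assumes D: "is_coalgebra C D" and [simp]: "M \<in> Obj C"
  shows "(\<one> (coalg_obj D \<otimes>\<^sub>o M) \<otimes> coalg_counit D) \<cdot> twist D M = \<one> (coalg_obj D \<otimes>\<^sub>o M)"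
proof -
  let ?X = "coalg_obj D" let ?d = "coalg_comult D" let ?e = "coalg_counit D"
  note [simp] = coalgebra_simps[OF D]
  have "(\<one> (?X \<otimes>\<^sub>o M) \<otimes> ?e) \<cdot> twist D M = (\<one> ?X \<otimes> ((\<one> M \<otimes> ?e) \<cdot> \<c> ?X M)) \<cdot> (?d \<otimes> \<one> M)"
    by (simp add: twist_def Interchange_Comp Tensor_Ident)
  also have "(\<one> M \<otimes> ?e) \<cdot> \<c> ?X M = ?e \<otimes> \<one> M"
    using Braid_natural[of ?e "\<one> M" K M] by simp
  also have "(\<one> ?X \<otimes> ?e \<otimes> \<one> M) \<cdot> (?d \<otimes> \<one> M) = ((\<one> ?X \<otimes> ?e) \<cdot> ?d) \<otimes> \<one> M"
    using Interchange[of ?d "\<one> ?X \<otimes> ?e" "\<one> M" "\<one> M"] by simp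
  also have "\<dots> = \<one> (?X \<otimes>\<^sub>o M)"
    using D by (simp add: is_coalgebra_def Let_def Tensor_Ident)
  finally show ?thesis .
qed

text \<open>In this form the facts about \<open>twist\<close> apply directly to the comultiplication
  of a tensor product.\<close>

lemma tensor_coalgebra_comult:
  assumes D: "is_coalgebra C D" and E: "is_coalgebra C E"
  shows "coalg_comult (tensor_coalgebra C D E)
    = (twist D (coalg_obj E) \<otimes> \<one> (coalg_obj E)) \<cdot> (\<one> (coalg_obj D) \<otimes> coalg_comult E)"
proof -
  let ?X = "coalg_obj D" let ?Y = "coalg_obj E" let ?d = "coalg_comult D" let ?e = "coalg_comult E"
  note [simp] = coalgebra_simps[OF D] coalgebra_simps[OF E]
  have "twist D ?Y \<otimes> \<one> ?Y = (\<one> ?X \<otimes> \<c> ?X ?Y \<otimes> \<one> ?Y) \<cdot> (?d \<otimes> \<one> ?Y \<otimes> \<one> ?Y)"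
    using Interchange[of "?d \<otimes> \<one> ?Y" "\<one> ?X \<otimes> \<c> ?X ?Y" "\<one> ?Y" "\<one> ?Y"] by (simp add: twist_def)
  moreover have "?d \<otimes> ?e = (?d \<otimes> \<one> ?Y \<otimes> \<one> ?Y) \<cdot> (\<one> ?X \<otimes> ?e)"
    by (simp add: Interchange flip: Tensor_Ident)
  ultimately show ?thesis by (simp add: tensor_coalgebra_def Comp_assoc)
qed

lemma tensor_coalgebra_sel [simp]:
  "coalg_obj (tensor_coalgebra C D E) = coalg_obj D \<otimes>\<^sub>o coalg_obj E"
  "coalg_counit (tensor_coalgebra C D E) = coalg_counit D \<otimes> coalg_counit E"
  by (simp_all add: tensor_coalgebra_def)

text \<open>Both sides produce \<open>d1 \<otimes> m \<otimes> d2 \<otimes> n \<otimes> d3\<close>,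
  and \<open>twist_coassoc\<close> identifies them. This is the coherence behind the associativity
  of convolution.\<close>

lemma twist_twist:
  assumes D: "is_coalgebra C D" and [simp]: "M \<in> Obj C" "N \<in> Obj C"
  shows "(twist D M \<otimes> \<one> (N \<otimes>\<^sub>o coalg_obj D)) \<cdot> twist D (M \<otimes>\<^sub>o N)
    = (\<one> (coalg_obj D \<otimes>\<^sub>o M) \<otimes> twist D N) \<cdot> (twist D M \<otimes> \<one> N)"
proof -
  let ?X = "coalg_obj D" let ?t = "twist D M" let ?d = "coalg_comult D"
  note [simp] = coalgebra_simps[OF D] twist_simps[OF D]
  have "(?t \<otimes> \<one> (N \<otimes>\<^sub>o ?X)) \<cdot> twist D (M \<otimes>\<^sub>o N)
      = ((?t \<otimes> \<one> (N \<otimes>\<^sub>o ?X)) \<cdot> (\<one> (?X \<otimes>\<^sub>o M) \<otimes> \<c> ?X N)) \<cdot> (?t \<otimes> \<one> N)"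
    by (simp add: twist_tensor[OF D] Comp_assoc)
  also have "(?t \<otimes> \<one> (N \<otimes>\<^sub>o ?X)) \<cdot> (\<one> (?X \<otimes>\<^sub>o M) \<otimes> \<c> ?X N)
      = (\<one> (?X \<otimes>\<^sub>o M \<otimes>\<^sub>o ?X) \<otimes> \<c> ?X N) \<cdot> (?t \<otimes> \<one> (?X \<otimes>\<^sub>o N))"
    by (simp add: Interchange)
  also have "(\<one> (?X \<otimes>\<^sub>o M \<otimes>\<^sub>o ?X) \<otimes> \<c> ?X N) \<cdot> (?t \<otimes> \<one> (?X \<otimes>\<^sub>o N)) \<cdot> (?t \<otimes> \<one> N)
      = (\<one> (?X \<otimes>\<^sub>o M \<otimes>\<^sub>o ?X) \<otimes> \<c> ?X N) \<cdot> (((?t \<otimes> \<one> ?X) \<cdot> ?t) \<otimes> \<one> N)"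
    using Interchange[of ?t "?t \<otimes> \<one> ?X" "\<one> N" "\<one> N"] by (simp add: Comp_assoc Tensor_Ident)
  also have "\<dots> = (\<one> (?X \<otimes>\<^sub>o M \<otimes>\<^sub>o ?X) \<otimes> \<c> ?X N) \<cdot> ((\<one> (?X \<otimes>\<^sub>o M) \<otimes> ?d \<otimes> \<one> N) \<cdot> (?t \<otimes> \<one> N))"
    using Interchange[of ?t "\<one> (?X \<otimes>\<^sub>o M) \<otimes> ?d" "\<one> N" "\<one> N"] by (simp add: twist_coassoc[OF D])
  also have "\<dots> = (\<one> (?X \<otimes>\<^sub>o M) \<otimes> twist D N) \<cdot> (?t \<otimes> \<one> N)"
    by (simp add: twist_def[of D N] Tensor_Ident Interchange_Comp Interchange)
  finally show ?thesis .
qed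

lemma twist_twist_tensor:
  assumes D: "is_coalgebra C D" and [simp]: "M \<in> Obj C" "N \<in> Obj C" "P \<in> Obj C"
  shows "(twist D M \<otimes> \<one> (N \<otimes>\<^sub>o coalg_obj D \<otimes>\<^sub>o P)) \<cdot> (twist D (M \<otimes>\<^sub>o N) \<otimes> \<one> P)
      = (\<one> (coalg_obj D \<otimes>\<^sub>o M) \<otimes> twist D N \<otimes> \<one> P) \<cdot> (twist D M \<otimes> \<one> (N \<otimes>\<^sub>o P))"
  using D twist_twist[OF D, of M N]
    Interchange[of "twist D (M \<otimes>\<^sub>o N)" "twist D M \<otimes> \<one> (N \<otimes>\<^sub>o coalg_obj D)" "\<one> P" "\<one> P"]
    Interchange[of "twist D M \<otimes> \<one> N" "\<one> (coalg_obj D \<otimes>\<^sub>o M) \<otimes> twist D N" "\<one> P" "\<one> P"]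
  by (simp add: Tensor_Ident)

text \<open>Needed to convolve over \<open>H \<otimes> H\<close>, where the associativity of an
  action is tested.\<close>

lemma is_coalgebra_tensor:
  assumes D: "is_coalgebra C D" and E: "is_coalgebra C E"
  shows "is_coalgebra C (tensor_coalgebra C D E)"
proof -
  let ?X = "coalg_obj D" let ?Y = "coalg_obj E" let ?d = "coalg_comult D" let ?e = "coalg_comult E"
  let ?\<delta> = "coalg_comult (tensor_coalgebra C D E)"
  let ?\<epsilon>D = "coalg_counit D" let ?\<epsilon>E = "coalg_counit E" let ?t = "twist D ?Y"
  note [simp] = coalgebra_simps[OF D] coalgebra_simps[OF E] twist_simps[OF D]
  note d = tensor_coalgebra_comult[OF D E]
  have "?\<delta> \<in> Hom (?X \<otimes>\<^sub>o ?Y) ((?X \<otimes>\<^sub>o ?Y) \<otimes>\<^sub>o ?X \<otimes>\<^sub>o ?Y)"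
    by (simp add: d Hom_iff)
  moreover have "((?\<epsilon>D \<otimes> ?\<epsilon>E) \<otimes> \<one> (?X \<otimes>\<^sub>o ?Y)) \<cdot> ?\<delta> = \<one> (?X \<otimes>\<^sub>o ?Y)"
  proof -
    have "(?\<epsilon>D \<otimes> ?\<epsilon>E \<otimes> \<one> ?X) \<cdot> ?t = ((?\<epsilon>D \<otimes> \<one> ?X) \<cdot> (\<one> ?X \<otimes> ?\<epsilon>E \<otimes> \<one> ?X)) \<cdot> ?t"
      using Interchange[of "\<one> ?X" "?\<epsilon>D" "?\<epsilon>E \<otimes> \<one> ?X" "\<one> ?X"] by simp
    \<comment> \<open>Since \<open>?\<epsilon>E\<close> ends in \<open>K\<close>, naturality turns
      the twist into the plain comultiplication of \<open>D\<close>, to which the counit law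
      applies.\<close>
    also have "\<dots> = (?\<epsilon>D \<otimes> \<one> ?X) \<cdot> (?d \<cdot> (\<one> ?X \<otimes> ?\<epsilon>E))"
      using twist_natural_right[OF D, of ?\<epsilon>E] by (simp add: Comp_assoc twist_unit[OF D])
    also have "\<dots> = ((?\<epsilon>D \<otimes> \<one> ?X) \<cdot> ?d) \<cdot> (\<one> ?X \<otimes> ?\<epsilon>E)"
      by (simp add: Comp_assoc)
    also have "\<dots> = \<one> ?X \<otimes> ?\<epsilon>E"
      using D by (simp add: is_coalgebra_def Let_def)
    finally have t: "(?\<epsilon>D \<otimes> ?\<epsilon>E \<otimes> \<one> ?X) \<cdot> ?t = \<one> ?X \<otimes> ?\<epsilon>E" .
    have "((?\<epsilon>D \<otimes> ?\<epsilon>E) \<otimes> \<one> (?X \<otimes>\<^sub>o ?Y)) \<cdot> ?\<delta>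
        = (((?\<epsilon>D \<otimes> ?\<epsilon>E \<otimes> \<one> ?X) \<cdot> ?t) \<otimes> \<one> ?Y) \<cdot> (\<one> ?X \<otimes> ?e)"
      using Interchange_Comp[of ?t "?\<epsilon>D \<otimes> ?\<epsilon>E \<otimes> \<one> ?X" "\<one> ?Y" "\<one> ?Y" "\<one> ?X \<otimes> ?e"]
      by (simp add: d Tensor_Ident)
    also have "\<dots> = \<one> ?X \<otimes> ((?\<epsilon>E \<otimes> \<one> ?Y) \<cdot> ?e)"
      unfolding t by (simp add: Interchange)
    also have "\<dots> = \<one> (?X \<otimes>\<^sub>o ?Y)"
      using E by (simp add: is_coalgebra_def Let_def Tensor_Ident)
    finally show ?thesis .
  qed
  moreover have "(\<one> (?X \<otimes>\<^sub>o ?Y) \<otimes> (?\<epsilon>D \<otimes> ?\<epsilon>E)) \<cdot> ?\<delta> = \<one> (?X \<otimes>\<^sub>o ?Y)"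
  proof -
    have "(\<one> (?X \<otimes>\<^sub>o ?Y) \<otimes> (?\<epsilon>D \<otimes> ?\<epsilon>E)) \<cdot> ?\<delta>
        = (((\<one> (?X \<otimes>\<^sub>o ?Y) \<otimes> ?\<epsilon>D) \<cdot> ?t) \<otimes> (?\<epsilon>E \<cdot> \<one> ?Y)) \<cdot> (\<one> ?X \<otimes> ?e)"
      using Interchange_Comp[of ?t "\<one> (?X \<otimes>\<^sub>o ?Y) \<otimes> ?\<epsilon>D" "\<one> ?Y" "?\<epsilon>E" "\<one> ?X \<otimes> ?e"]
      by (simp add: d)
    also have "\<dots> = \<one> ?X \<otimes> ((\<one> ?Y \<otimes> ?\<epsilon>E) \<cdot> ?e)"
      unfolding twist_counit[OF D coalgebra_simps(1)[OF E]] by (simp add: Interchange Tensor_Ident)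
    also have "\<dots> = \<one> (?X \<otimes>\<^sub>o ?Y)"
      using E by (simp add: is_coalgebra_def Let_def Tensor_Ident)
    finally show ?thesis .
  qed
  moreover have "(?\<delta> \<otimes> \<one> (?X \<otimes>\<^sub>o ?Y)) \<cdot> ?\<delta> = (\<one> (?X \<otimes>\<^sub>o ?Y) \<otimes> ?\<delta>) \<cdot> ?\<delta>"
  proof -
    let ?Z = "?Y \<otimes>\<^sub>o ?X \<otimes>\<^sub>o ?Y"
    \<comment> \<open>\<open>?s\<close> distributes three copies of \<open>D\<close> among three
      factors of \<open>E\<close>. Both sides factor through it, and what remains is coassociativity
      of \<open>E\<close>.\<close>
    let ?s = "(\<one> (?X \<otimes>\<^sub>o ?Y) \<otimes> ?t \<otimes> \<one> ?Y) \<cdot> (?t \<otimes> \<one> (?Y \<otimes>\<^sub>o ?Y))"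
    have "?\<delta> \<otimes> \<one> (?X \<otimes>\<^sub>o ?Y) = (?t \<otimes> \<one> ?Z) \<cdot> (\<one> ?X \<otimes> ?e \<otimes> \<one> (?X \<otimes>\<^sub>o ?Y))"
      using Interchange[of "\<one> ?X \<otimes> ?e" "?t \<otimes> \<one> ?Y" "\<one> (?X \<otimes>\<^sub>o ?Y)" "\<one> (?X \<otimes>\<^sub>o ?Y)"]
      by (simp add: d Tensor_Ident)
    moreover have "(\<one> ?X \<otimes> ?e \<otimes> \<one> (?X \<otimes>\<^sub>o ?Y)) \<cdot> (?t \<otimes> \<one> ?Y)
        = (twist D (?Y \<otimes>\<^sub>o ?Y) \<otimes> \<one> ?Y) \<cdot> (\<one> ?X \<otimes> ?e \<otimes> \<one> ?Y)"
      using Interchange[of ?t "\<one> ?X \<otimes> ?e \<otimes> \<one> ?X" "\<one> ?Y" "\<one> ?Y"]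
        Interchange[of "\<one> ?X \<otimes> ?e" "twist D (?Y \<otimes>\<^sub>o ?Y)" "\<one> ?Y" "\<one> ?Y"]
        twist_natural_right[OF D, of ?e]
      by (simp add: Tensor_Ident)
    ultimately have "(?\<delta> \<otimes> \<one> (?X \<otimes>\<^sub>o ?Y)) \<cdot> ?\<delta> = ((?t \<otimes> \<one> ?Z) \<cdot> (twist D (?Y \<otimes>\<^sub>o ?Y) \<otimes> \<one> ?Y))
        \<cdot> ((\<one> ?X \<otimes> ?e \<otimes> \<one> ?Y) \<cdot> (\<one> ?X \<otimes> ?e))"
      by (simp add: d Comp_assoc) (simp flip: Comp_assoc)
    also have "\<dots> = ?s \<cdot> (\<one> ?X \<otimes> ((?e \<otimes> \<one> ?Y) \<cdot> ?e))"
      by (simp add: twist_twist_tensor[OF D] Interchange)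
    also have "(?e \<otimes> \<one> ?Y) \<cdot> ?e = (\<one> ?Y \<otimes> ?e) \<cdot> ?e"
      using E by (simp add: is_coalgebra_def Let_def)
    finally have l: "(?\<delta> \<otimes> \<one> (?X \<otimes>\<^sub>o ?Y)) \<cdot> ?\<delta> = ?s \<cdot> (\<one> ?X \<otimes> ((\<one> ?Y \<otimes> ?e) \<cdot> ?e))" .
    have "\<one> (?X \<otimes>\<^sub>o ?Y) \<otimes> ?\<delta> = (\<one> (?X \<otimes>\<^sub>o ?Y) \<otimes> ?t \<otimes> \<one> ?Y) \<cdot> (\<one> (?X \<otimes>\<^sub>o ?Y \<otimes>\<^sub>o ?X) \<otimes> ?e)"
      by (simp add: d Tensor_Ident Interchange)
    moreover have "(\<one> (?X \<otimes>\<^sub>o ?Y \<otimes>\<^sub>o ?X) \<otimes> ?e) \<cdot> (?t \<otimes> \<one> ?Y)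
        = (?t \<otimes> \<one> (?Y \<otimes>\<^sub>o ?Y)) \<cdot> (\<one> (?X \<otimes>\<^sub>o ?Y) \<otimes> ?e)"
      by (simp add: Interchange)
    ultimately have "(\<one> (?X \<otimes>\<^sub>o ?Y) \<otimes> ?\<delta>) \<cdot> ?\<delta> = ?s \<cdot> ((\<one> (?X \<otimes>\<^sub>o ?Y) \<otimes> ?e) \<cdot> (\<one> ?X \<otimes> ?e))"
      by (simp add: d Comp_assoc) (simp flip: Comp_assoc)
    then show ?thesis
      unfolding l by (simp add: Interchange Tensor_Ident)
  qed
  ultimately show ?thesis
    unfolding is_coalgebra_def Let_def by (simp add: Hom_iff)
qed

text \<open>Convolution with parameters: \<open>f(d1 \<otimes> m) g(d2 \<otimes> n)\<close>.
  \<open>M\<close> and \<open>N\<close> are explicit arguments because the domains of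
  \<open>f\<close> and \<open>g\<close> need not determine them; \<open>M = N = K\<close> gives the
  usual convolution of arrows from \<open>D\<close> to \<open>A\<close>.\<close>

definition conv :: "('o, 'm) algebra \<Rightarrow> ('o, 'm) coalgebra \<Rightarrow> 'o \<Rightarrow> 'o \<Rightarrow> 'm \<Rightarrow> 'm \<Rightarrow> 'm"
  where "conv A D M N f g = alg_mult A \<cdot> ((f \<otimes> g) \<cdot> (twist D M \<otimes> \<one> N))"

lemma conv_hom [simp]:
  assumes "is_algebra C A" "is_coalgebra C D" "M \<in> Obj C" "N \<in> Obj C"
    "f \<in> Arr C" "Dom C f = coalg_obj D \<otimes>\<^sub>o M" "Cod C f = alg_obj A"
    "g \<in> Arr C" "Dom C g = coalg_obj D \<otimes>\<^sub>o N" "Cod C g = alg_obj A"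
  shows "conv A D M N f g \<in> Arr C" "Dom C (conv A D M N f g) = coalg_obj D \<otimes>\<^sub>o M \<otimes>\<^sub>o N"
    "Cod C (conv A D M N f g) = alg_obj A"
  using assms by (simp_all add: conv_def)

text \<open>Associativity of the multiplication handles the values,
  \<open>twist_twist_tensor\<close> the three copies of \<open>D\<close>.\<close>

lemma conv_assoc:
  assumes A: "is_algebra C A" and D: "is_coalgebra C D"
    and [simp]: "M \<in> Obj C" "N \<in> Obj C" "P \<in> Obj C"
    and [simp]: "f \<in> Arr C" "Dom C f = coalg_obj D \<otimes>\<^sub>o M" "Cod C f = alg_obj A"
    "g \<in> Arr C" "Dom C g = coalg_obj D \<otimes>\<^sub>o N" "Cod C g = alg_obj A"
    "h \<in> Arr C" "Dom C h = coalg_obj D \<otimes>\<^sub>o P" "Cod C h = alg_obj A"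
  shows "conv A D (M \<otimes>\<^sub>o N) P (conv A D M N f g) h = conv A D M (N \<otimes>\<^sub>o P) f (conv A D N P g h)"
proof -
  let ?X = "coalg_obj D" let ?A = "alg_obj A" let ?\<mu> = "alg_mult A"
  note [simp] = coalgebra_simps[OF D] twist_simps[OF D] algebra_simps[OF A]
  have as: "?\<mu> \<cdot> (?\<mu> \<otimes> \<one> ?A) = ?\<mu> \<cdot> (\<one> ?A \<otimes> ?\<mu>)"
    using A by (simp add: is_algebra_def Let_def)
  have "conv A D M N f g \<otimes> h = (?\<mu> \<otimes> \<one> ?A) \<cdot> ((f \<otimes> g \<otimes> h) \<cdot> (twist D M \<otimes> \<one> (N \<otimes>\<^sub>o ?X \<otimes>\<^sub>o P)))"
    using Interchange[of "twist D M \<otimes> \<one> N" "f \<otimes> g" "\<one> (?X \<otimes>\<^sub>o P)" h]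
    by (simp add: conv_def Tensor_Ident Interchange)
  then have "conv A D (M \<otimes>\<^sub>o N) P (conv A D M N f g) h
      = (?\<mu> \<cdot> (?\<mu> \<otimes> \<one> ?A)) \<cdot> ((f \<otimes> g \<otimes> h) \<cdot>
          ((twist D M \<otimes> \<one> (N \<otimes>\<^sub>o ?X \<otimes>\<^sub>o P)) \<cdot> (twist D (M \<otimes>\<^sub>o N) \<otimes> \<one> P)))"
    by (simp add: conv_def[of A D "M \<otimes>\<^sub>o N"] Comp_assoc)
  also have "\<dots> = (?\<mu> \<cdot> (\<one> ?A \<otimes> ?\<mu>)) \<cdot> ((f \<otimes> g \<otimes> h) \<cdot>
          ((\<one> (?X \<otimes>\<^sub>o M) \<otimes> twist D N \<otimes> \<one> P) \<cdot> (twist D M \<otimes> \<one> (N \<otimes>\<^sub>o P))))"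
    unfolding twist_twist_tensor[OF D assms(3-5)] as ..
  also have "\<dots> = ?\<mu> \<cdot> ((f \<otimes> conv A D N P g h) \<cdot> (twist D M \<otimes> \<one> (N \<otimes>\<^sub>o P)))"
    by (simp add: conv_def Comp_assoc Interchange_Comp)
  finally show ?thesis by (simp add: conv_def[of A D M])
qed

lemma conv_unit_left:
  assumes A: "is_algebra C A" and D: "is_coalgebra C D"
    and [simp]: "N \<in> Obj C" "g \<in> Arr C" "Dom C g = coalg_obj D \<otimes>\<^sub>o N" "Cod C g = alg_obj A"
  shows "conv A D K N (alg_unit A \<cdot> coalg_counit D) g = g"
proof -
  let ?X = "coalg_obj D" let ?A = "alg_obj A" let ?\<mu> = "alg_mult A"
  note [simp] = coalgebra_simps[OF D] twist_simps[OF D] algebra_simps[OF A]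
  have "conv A D K N (alg_unit A \<cdot> coalg_counit D) g
     = ?\<mu> \<cdot> (((alg_unit A \<otimes> \<one> ?A) \<cdot> (coalg_counit D \<otimes> g)) \<cdot> (coalg_comult D \<otimes> \<one> N))"
    by (simp add: conv_def twist_unit[OF D] Interchange)
  also have "coalg_counit D \<otimes> g = g \<cdot> (coalg_counit D \<otimes> \<one> ?X \<otimes> \<one> N)"
    using Interchange[of "coalg_counit D" "\<one> K" "\<one> ?X \<otimes> \<one> N" g] by (simp flip: Tensor_Ident)
  also have "?\<mu> \<cdot> (((alg_unit A \<otimes> \<one> ?A) \<cdot> (g \<cdot> (coalg_counit D \<otimes> \<one> ?X \<otimes> \<one> N))) \<cdot> (coalg_comult D \<otimes> \<one> N))
     = (?\<mu> \<cdot> (alg_unit A \<otimes> \<one> ?A)) \<cdot> (g \<cdot> (((coalg_counit D \<otimes> \<one> ?X) \<otimes> \<one> N) \<cdot> (coalg_comult D \<otimes> \<one> N)))"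
    by (simp add: Comp_assoc)
  also have "\<dots> = (?\<mu> \<cdot> (alg_unit A \<otimes> \<one> ?A)) \<cdot> (g \<cdot> (((coalg_counit D \<otimes> \<one> ?X) \<cdot> coalg_comult D) \<otimes> \<one> N))"
    by (subst Interchange) simp_all
  also have "\<dots> = g"
    using A D by (simp add: is_algebra_def is_coalgebra_def Let_def flip: Tensor_Ident)
  finally show ?thesis .
qed

text \<open>The shared factor is copied, so \<open>k\<close> must respect comultiplication to pass
  into both arguments; each parameter occurs once and may be substituted along any arrow.\<close>

lemma conv_comp:
  assumes A: "is_algebra C A" and D: "is_coalgebra C D" and D': "is_coalgebra C D'"
    and k: "coalgebra_morphism C D D' k"
    and [simp]: "m \<in> Arr C" "n \<in> Arr C"
    and [simp]: "f \<in> Arr C" "Dom C f = coalg_obj D' \<otimes>\<^sub>o Cod C m" "Cod C f = alg_obj A"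
    "g \<in> Arr C" "Dom C g = coalg_obj D' \<otimes>\<^sub>o Cod C n" "Cod C g = alg_obj A"
  shows "conv A D' (Cod C m) (Cod C n) f g \<cdot> (k \<otimes> m \<otimes> n)
    = conv A D (Dom C m) (Dom C n) (f \<cdot> (k \<otimes> m)) (g \<cdot> (k \<otimes> n))"
proof -
  note [simp] = coalgebra_simps[OF D] twist_simps[OF D] coalgebra_simps[OF D'] twist_simps[OF D']
    algebra_simps[OF A]
  have [simp]: "k \<in> Arr C" "Dom C k = coalg_obj D" "Cod C k = coalg_obj D'"
    using k by (simp_all add: coalgebra_morphism_def Hom_iff)
  have "(twist D' (Cod C m) \<otimes> \<one> (Cod C n)) \<cdot> (k \<otimes> m \<otimes> n)
      = (k \<otimes> m \<otimes> k \<otimes> n) \<cdot> (twist D (Dom C m) \<otimes> \<one> (Dom C n))"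
    using Interchange[of "k \<otimes> m" "twist D' (Cod C m)" n "\<one> (Cod C n)"]
      Interchange[of "twist D (Dom C m)" "k \<otimes> m \<otimes> k" "\<one> (Dom C n)" n]
    by (simp add: twist_natural[OF D D' k])
  then have "conv A D' (Cod C m) (Cod C n) f g \<cdot> (k \<otimes> m \<otimes> n)
      = alg_mult A \<cdot> ((f \<otimes> g) \<cdot> (((k \<otimes> m) \<otimes> (k \<otimes> n)) \<cdot> (twist D (Dom C m) \<otimes> \<one> (Dom C n))))"
    by (simp add: conv_def Comp_assoc)
  also have "\<dots> = conv A D (Dom C m) (Dom C n) (f \<cdot> (k \<otimes> m)) (g \<cdot> (k \<otimes> n))"
    by (subst Interchange_Comp) (simp_all add: conv_def)
  finally show ?thesis .
qed

lemma conv_algebra_morphism: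
  assumes A: "is_algebra C A" and A': "is_algebra C A'" and D: "is_coalgebra C D"
    and w: "algebra_morphism C A A' w"
    and [simp]: "M \<in> Obj C" "N \<in> Obj C" "f \<in> Arr C" "Dom C f = coalg_obj D \<otimes>\<^sub>o M" "Cod C f = alg_obj A"
    "g \<in> Arr C" "Dom C g = coalg_obj D \<otimes>\<^sub>o N" "Cod C g = alg_obj A"
  shows "w \<cdot> conv A D M N f g = conv A' D M N (w \<cdot> f) (w \<cdot> g)"
proof -
  note [simp] = coalgebra_simps[OF D] twist_simps[OF D] algebra_simps[OF A] algebra_simps[OF A']
  have [simp]: "w \<in> Arr C" "Dom C w = alg_obj A" "Cod C w = alg_obj A'"
    and wm: "w \<cdot> alg_mult A = alg_mult A' \<cdot> (w \<otimes> w)"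
    using w by (simp_all add: algebra_morphism_def Hom_iff)
  have "w \<cdot> conv A D M N f g = (w \<cdot> alg_mult A) \<cdot> ((f \<otimes> g) \<cdot> (twist D M \<otimes> \<one> N))"
    by (simp add: conv_def Comp_assoc)
  also have "\<dots> = conv A' D M N (w \<cdot> f) (w \<cdot> g)"
    unfolding wm by (simp add: conv_def Comp_assoc Interchange_Comp)
  finally show ?thesis .
qed

text \<open>Associativity brings \<open>q\<close> next to \<open>p\<close>. It is applied both with
  \<open>q\<close> the antipode composite and with \<open>p\<close> the antipode composite.\<close>

lemma conv_cancel:
  assumes A: "is_algebra C A" and D: "is_coalgebra C D" and [simp]: "N \<in> Obj C"
    and [simp]: "p \<in> Arr C" "Dom C p = coalg_obj D" "Cod C p = alg_obj A"
    "q \<in> Arr C" "Dom C q = coalg_obj D" "Cod C q = alg_obj A"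
    "g \<in> Arr C" "Dom C g = coalg_obj D \<otimes>\<^sub>o N" "Cod C g = alg_obj A"
    and inv: "conv A D K K q p = alg_unit A \<cdot> coalg_counit D"
  shows "conv A D K N q (conv A D K N p g) = g"
  using conv_assoc[OF A D, of K K N q p g] conv_unit_left[OF A D, of N g] inv coalgebra_simps[OF D]
  by simp


section \<open>Convolution in a tensor product of algebras\<close>

lemma tensor_algebra_sel [simp]:
  "alg_obj (tensor_algebra C A B) = alg_obj A \<otimes>\<^sub>o alg_obj B"
  "alg_unit (tensor_algebra C A B) = alg_unit A \<otimes> alg_unit B"
  by (simp_all add: tensor_algebra_def)

lemma tensor_algebra_mult_simps [simp]:
  assumes "is_algebra C A" "is_algebra C B"
  shows "alg_mult (tensor_algebra C A B) \<in> Arr C"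
    "Dom C (alg_mult (tensor_algebra C A B)) = alg_obj A \<otimes>\<^sub>o alg_obj B \<otimes>\<^sub>o alg_obj A \<otimes>\<^sub>o alg_obj B"
    "Cod C (alg_mult (tensor_algebra C A B)) = alg_obj A \<otimes>\<^sub>o alg_obj B"
  using assms by (simp_all add: tensor_algebra_def)

text \<open>Naturality moves the braiding to the domains of \<open>g\<close> and \<open>h\<close>,
  where it is an identity as soon as one of these domains is \<open>K\<close>.\<close>

lemma tensor_algebra_mult:
  assumes A: "is_algebra C A" and B: "is_algebra C B"
    and [simp]: "f \<in> Arr C" "Cod C f = alg_obj A" "g \<in> Arr C" "Cod C g = alg_obj B"
    "h \<in> Arr C" "Cod C h = alg_obj A" "k \<in> Arr C" "Cod C k = alg_obj B"
  shows "alg_mult (tensor_algebra C A B) \<cdot> (f \<otimes> g \<otimes> h \<otimes> k)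
    = (alg_mult A \<otimes> alg_mult B) \<cdot> (f \<otimes> ((h \<otimes> g) \<cdot> \<c> (Dom C g) (Dom C h)) \<otimes> k)"
proof -
  let ?X = "alg_obj A" let ?Y = "alg_obj B"
  note [simp] = algebra_simps[OF A] algebra_simps[OF B]
  have "(\<one> ?X \<otimes> \<c> ?Y ?X \<otimes> \<one> ?Y) \<cdot> (f \<otimes> g \<otimes> h \<otimes> k) = f \<otimes> (\<c> ?Y ?X \<cdot> (g \<otimes> h)) \<otimes> k"
    using Interchange[of "g \<otimes> h" "\<c> ?Y ?X" k "\<one> ?Y"] by (simp add: Interchange)
  also have "\<c> ?Y ?X \<cdot> (g \<otimes> h) = (h \<otimes> g) \<cdot> \<c> (Dom C g) (Dom C h)"
    by (simp add: Braid_natural)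
  finally show ?thesis
    by (simp add: tensor_algebra_def Comp_assoc)
qed

lemma tensor_algebra_mult_unbraided:
  assumes A: "is_algebra C A" and B: "is_algebra C B"
    and [simp]: "f \<in> Arr C" "Cod C f = alg_obj A" "g \<in> Arr C" "Cod C g = alg_obj B"
    "h \<in> Arr C" "Cod C h = alg_obj A" "k \<in> Arr C" "Cod C k = alg_obj B"
    and "Dom C g = K \<or> Dom C h = K"
  shows "alg_mult (tensor_algebra C A B) \<cdot> (f \<otimes> g \<otimes> h \<otimes> k)
    = (alg_mult A \<cdot> (f \<otimes> h)) \<otimes> (alg_mult B \<cdot> (g \<otimes> k))"
proof -
  note [simp] = algebra_simps[OF A] algebra_simps[OF B]
  have "(h \<otimes> g) \<cdot> \<c> (Dom C g) (Dom C h) = h \<otimes> g"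
    using assms(11) by auto
  then show ?thesis
    using Interchange[of "f \<otimes> h" "alg_mult A" "g \<otimes> k" "alg_mult B"]
    by (simp add: tensor_algebra_mult[OF A B])
qed

text \<open>Makes \<open>B \<otimes> B\<close> a target for convolutions, which turns
  comultiplicativity into a statement about them.\<close>

lemma is_algebra_tensor:
  assumes A: "is_algebra C A" and B: "is_algebra C B"
  shows "is_algebra C (tensor_algebra C A B)"
proof -
  let ?X = "alg_obj A" let ?Y = "alg_obj B" let ?m = "alg_mult A" let ?n = "alg_mult B"
  let ?\<mu> = "alg_mult (tensor_algebra C A B)" let ?c = "\<c> ?Y ?X"
  note [simp] = algebra_simps[OF A] algebra_simps[OF B] tensor_algebra_mult_simps[OF A B]
  have "?\<mu> \<cdot> ((alg_unit A \<otimes> alg_unit B) \<otimes> \<one> (?X \<otimes>\<^sub>o ?Y)) = \<one> (?X \<otimes>\<^sub>o ?Y)"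
    using A B tensor_algebra_mult_unbraided[OF A B, of "alg_unit A" "alg_unit B" "\<one> ?X" "\<one> ?Y"]
    by (simp add: Tensor_Ident is_algebra_def Let_def)
  moreover have "?\<mu> \<cdot> (\<one> (?X \<otimes>\<^sub>o ?Y) \<otimes> (alg_unit A \<otimes> alg_unit B)) = \<one> (?X \<otimes>\<^sub>o ?Y)"
    using A B tensor_algebra_mult_unbraided[OF A B, of "\<one> ?X" "\<one> ?Y" "alg_unit A" "alg_unit B"]
    by (simp add: Tensor_Ident is_algebra_def Let_def)
  moreover have "?\<mu> \<cdot> (?\<mu> \<otimes> \<one> (?X \<otimes>\<^sub>o ?Y)) = ?\<mu> \<cdot> (\<one> (?X \<otimes>\<^sub>o ?Y) \<otimes> ?\<mu>)"
  proof -
    \<comment> \<open>\<open>?r\<close> sorts \<open>X Y X Y X Y\<close> into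
      \<open>X X X Y Y Y\<close>. Both bracketings reduce to it, followed by the threefold products
      of \<open>A\<close> and of \<open>B\<close>.\<close>
    let ?r = "\<one> ?X \<otimes> ((\<one> ?X \<otimes> ?c \<otimes> \<one> ?Y) \<cdot> (?c \<otimes> ?c)) \<otimes> \<one> ?Y"
    have m: "?m \<cdot> (?m \<otimes> \<one> ?X) = ?m \<cdot> (\<one> ?X \<otimes> ?m)" and n: "?n \<cdot> (?n \<otimes> \<one> ?Y) = ?n \<cdot> (\<one> ?Y \<otimes> ?n)"
      using A B by (simp_all add: is_algebra_def Let_def)
    have w: "\<one> ?X \<otimes> (g \<cdot> f) \<otimes> \<one> ?Y = (\<one> ?X \<otimes> g \<otimes> \<one> ?Y) \<cdot> (\<one> ?X \<otimes> f \<otimes> \<one> ?Y)"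
      if "f \<in> Arr C" "g \<in> Arr C" "Dom C g = Cod C f" for f g
      using that Interchange[of f g "\<one> ?Y" "\<one> ?Y"] by (simp add: Interchange)
    have "?\<mu> \<otimes> \<one> (?X \<otimes>\<^sub>o ?Y) = (?m \<otimes> ?n \<otimes> \<one> ?X \<otimes> \<one> ?Y) \<cdot> (\<one> ?X \<otimes> (?c \<otimes> \<one> (?Y \<otimes>\<^sub>o ?X)) \<otimes> \<one> ?Y)"
      using Interchange[of "\<one> ?X \<otimes> ?c \<otimes> \<one> ?Y" "?m \<otimes> ?n" "\<one> (?X \<otimes>\<^sub>o ?Y)" "\<one> (?X \<otimes>\<^sub>o ?Y)"]
      by (simp add: tensor_algebra_def Tensor_Ident)
    then have "?\<mu> \<cdot> (?\<mu> \<otimes> \<one> (?X \<otimes>\<^sub>o ?Y))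
        = (?\<mu> \<cdot> (?m \<otimes> ?n \<otimes> \<one> ?X \<otimes> \<one> ?Y)) \<cdot> (\<one> ?X \<otimes> (?c \<otimes> \<one> (?Y \<otimes>\<^sub>o ?X)) \<otimes> \<one> ?Y)"
      by (simp add: Comp_assoc)
    also have "?\<mu> \<cdot> (?m \<otimes> ?n \<otimes> \<one> ?X \<otimes> \<one> ?Y)
        = (?m \<otimes> ?n) \<cdot> (?m \<otimes> ((\<one> ?X \<otimes> ?n) \<cdot> \<c> (?Y \<otimes>\<^sub>o ?Y) ?X) \<otimes> \<one> ?Y)"
      by (simp add: tensor_algebra_mult[OF A B])
    also have "?m \<otimes> ((\<one> ?X \<otimes> ?n) \<cdot> \<c> (?Y \<otimes>\<^sub>o ?Y) ?X) \<otimes> \<one> ?Y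
        = ((?m \<otimes> \<one> ?X) \<otimes> (?n \<otimes> \<one> ?Y)) \<cdot> (\<one> ?X \<otimes> (\<one> ?X \<otimes> \<c> (?Y \<otimes>\<^sub>o ?Y) ?X) \<otimes> \<one> ?Y)"
      using Interchange[of "\<one> (?X \<otimes>\<^sub>o ?X)" ?m "\<c> (?Y \<otimes>\<^sub>o ?Y) ?X \<otimes> \<one> ?Y" "\<one> ?X \<otimes> ?n \<otimes> \<one> ?Y"]
        Interchange[of "\<c> (?Y \<otimes>\<^sub>o ?Y) ?X" "\<one> ?X \<otimes> ?n" "\<one> ?Y" "\<one> ?Y"]
      by (simp add: Tensor_Ident)
    also have "((?m \<otimes> ?n) \<cdot> \<dots>) \<cdot> (\<one> ?X \<otimes> (?c \<otimes> \<one> (?Y \<otimes>\<^sub>o ?X)) \<otimes> \<one> ?Y)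
        = ((?m \<otimes> ?n) \<cdot> ((?m \<otimes> \<one> ?X) \<otimes> (?n \<otimes> \<one> ?Y))) \<cdot>
          ((\<one> ?X \<otimes> (\<one> ?X \<otimes> \<c> (?Y \<otimes>\<^sub>o ?Y) ?X) \<otimes> \<one> ?Y) \<cdot> (\<one> ?X \<otimes> (?c \<otimes> \<one> (?Y \<otimes>\<^sub>o ?X)) \<otimes> \<one> ?Y))"
      by (simp add: Comp_assoc)
    also have "(?m \<otimes> ?n) \<cdot> ((?m \<otimes> \<one> ?X) \<otimes> (?n \<otimes> \<one> ?Y)) = (?m \<cdot> (\<one> ?X \<otimes> ?m)) \<otimes> (?n \<cdot> (\<one> ?Y \<otimes> ?n))"
      by (subst Interchange) (simp_all add: m n)
    also have "(\<one> ?X \<otimes> (\<one> ?X \<otimes> \<c> (?Y \<otimes>\<^sub>o ?Y) ?X) \<otimes> \<one> ?Y) \<cdot> (\<one> ?X \<otimes> (?c \<otimes> \<one> (?Y \<otimes>\<^sub>o ?X)) \<otimes> \<one> ?Y)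
       = \<one> ?X \<otimes> ((\<one> ?X \<otimes> \<c> (?Y \<otimes>\<^sub>o ?Y) ?X) \<cdot> (?c \<otimes> \<one> (?Y \<otimes>\<^sub>o ?X))) \<otimes> \<one> ?Y"
      by (subst w) simp_all
    also have "(\<one> ?X \<otimes> \<c> (?Y \<otimes>\<^sub>o ?Y) ?X) \<cdot> (?c \<otimes> \<one> (?Y \<otimes>\<^sub>o ?X)) = (\<one> ?X \<otimes> ?c \<otimes> \<one> ?Y) \<cdot> (?c \<otimes> ?c)"
    proof -
      have "\<one> ?X \<otimes> \<c> (?Y \<otimes>\<^sub>o ?Y) ?X = (\<one> ?X \<otimes> ?c \<otimes> \<one> ?Y) \<cdot> (\<one> (?X \<otimes>\<^sub>o ?Y) \<otimes> ?c)"
        by (simp add: hexagon2 Tensor_Ident Interchange)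
      moreover have "?c \<otimes> ?c = (\<one> (?X \<otimes>\<^sub>o ?Y) \<otimes> ?c) \<cdot> (?c \<otimes> \<one> (?Y \<otimes>\<^sub>o ?X))"
        by (simp add: Interchange)
      ultimately show ?thesis by (simp add: Comp_assoc)
    qed
    finally have l: "?\<mu> \<cdot> (?\<mu> \<otimes> \<one> (?X \<otimes>\<^sub>o ?Y))
        = ((?m \<cdot> (\<one> ?X \<otimes> ?m)) \<otimes> (?n \<cdot> (\<one> ?Y \<otimes> ?n))) \<cdot> ?r" .
    have "\<one> (?X \<otimes>\<^sub>o ?Y) \<otimes> ?\<mu> = (\<one> ?X \<otimes> \<one> ?Y \<otimes> ?m \<otimes> ?n) \<cdot> (\<one> ?X \<otimes> (\<one> (?Y \<otimes>\<^sub>o ?X) \<otimes> ?c) \<otimes> \<one> ?Y)"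
      by (simp add: tensor_algebra_def Tensor_Ident Interchange)
    then have "?\<mu> \<cdot> (\<one> (?X \<otimes>\<^sub>o ?Y) \<otimes> ?\<mu>)
        = (?\<mu> \<cdot> (\<one> ?X \<otimes> \<one> ?Y \<otimes> ?m \<otimes> ?n)) \<cdot> (\<one> ?X \<otimes> (\<one> (?Y \<otimes>\<^sub>o ?X) \<otimes> ?c) \<otimes> \<one> ?Y)"
      by (simp add: Comp_assoc)
    also have "?\<mu> \<cdot> (\<one> ?X \<otimes> \<one> ?Y \<otimes> ?m \<otimes> ?n)
        = (?m \<otimes> ?n) \<cdot> (\<one> ?X \<otimes> ((?m \<otimes> \<one> ?Y) \<cdot> \<c> ?Y (?X \<otimes>\<^sub>o ?X)) \<otimes> ?n)"
      by (simp add: tensor_algebra_mult[OF A B])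
    also have "\<one> ?X \<otimes> ((?m \<otimes> \<one> ?Y) \<cdot> \<c> ?Y (?X \<otimes>\<^sub>o ?X)) \<otimes> ?n
        = ((\<one> ?X \<otimes> ?m) \<otimes> (\<one> ?Y \<otimes> ?n)) \<cdot> (\<one> ?X \<otimes> (\<c> ?Y (?X \<otimes>\<^sub>o ?X) \<otimes> \<one> ?Y) \<otimes> \<one> ?Y)"
      using Interchange[of "\<c> ?Y (?X \<otimes>\<^sub>o ?X)" "?m \<otimes> \<one> ?Y" "\<one> (?Y \<otimes>\<^sub>o ?Y)" ?n]
      by (simp add: Tensor_Ident Interchange)
    also have "((?m \<otimes> ?n) \<cdot> \<dots>) \<cdot> (\<one> ?X \<otimes> (\<one> (?Y \<otimes>\<^sub>o ?X) \<otimes> ?c) \<otimes> \<one> ?Y)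
        = ((?m \<otimes> ?n) \<cdot> ((\<one> ?X \<otimes> ?m) \<otimes> (\<one> ?Y \<otimes> ?n))) \<cdot>
          ((\<one> ?X \<otimes> (\<c> ?Y (?X \<otimes>\<^sub>o ?X) \<otimes> \<one> ?Y) \<otimes> \<one> ?Y) \<cdot> (\<one> ?X \<otimes> (\<one> (?Y \<otimes>\<^sub>o ?X) \<otimes> ?c) \<otimes> \<one> ?Y))"
      by (simp add: Comp_assoc)
    also have "(?m \<otimes> ?n) \<cdot> ((\<one> ?X \<otimes> ?m) \<otimes> (\<one> ?Y \<otimes> ?n)) = (?m \<cdot> (\<one> ?X \<otimes> ?m)) \<otimes> (?n \<cdot> (\<one> ?Y \<otimes> ?n))"
      by (subst Interchange) simp_all
    also have "(\<one> ?X \<otimes> (\<c> ?Y (?X \<otimes>\<^sub>o ?X) \<otimes> \<one> ?Y) \<otimes> \<one> ?Y) \<cdot> (\<one> ?X \<otimes> (\<one> (?Y \<otimes>\<^sub>o ?X) \<otimes> ?c) \<otimes> \<one> ?Y)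
       = \<one> ?X \<otimes> ((\<c> ?Y (?X \<otimes>\<^sub>o ?X) \<otimes> \<one> ?Y) \<cdot> (\<one> (?Y \<otimes>\<^sub>o ?X) \<otimes> ?c)) \<otimes> \<one> ?Y"
      by (subst w) simp_all
    also have "(\<c> ?Y (?X \<otimes>\<^sub>o ?X) \<otimes> \<one> ?Y) \<cdot> (\<one> (?Y \<otimes>\<^sub>o ?X) \<otimes> ?c) = (\<one> ?X \<otimes> ?c \<otimes> \<one> ?Y) \<cdot> (?c \<otimes> ?c)"
    proof -
      have "\<c> ?Y (?X \<otimes>\<^sub>o ?X) \<otimes> \<one> ?Y = (\<one> ?X \<otimes> ?c \<otimes> \<one> ?Y) \<cdot> (?c \<otimes> \<one> (?X \<otimes>\<^sub>o ?Y))"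
        using Interchange[of "?c \<otimes> \<one> ?X" "\<one> ?X \<otimes> ?c" "\<one> ?Y" "\<one> ?Y"]
        by (simp add: hexagon1 Tensor_Ident)
      moreover have "?c \<otimes> ?c = (?c \<otimes> \<one> (?X \<otimes>\<^sub>o ?Y)) \<cdot> (\<one> (?Y \<otimes>\<^sub>o ?X) \<otimes> ?c)"
        by (simp add: Interchange)
      ultimately show ?thesis by (simp add: Comp_assoc)
    qed
    finally show ?thesis unfolding l by simp
  qed
  ultimately show ?thesis
    unfolding is_algebra_def Let_def by (simp add: Hom_iff)
qed

text \<open>Between two elements of the first factor only a unit of \<open>B\<close> has to be
  crossed, so no braiding survives.\<close>

lemma algebra_morphism_tensor_left:
  assumes A: "is_algebra C A" and B: "is_algebra C B"
  shows "algebra_morphism C A (tensor_algebra C A B) (\<one> (alg_obj A) \<otimes> alg_unit B)"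
proof -
  note [simp] = algebra_simps[OF A] algebra_simps[OF B]
  have "(\<one> (alg_obj A) \<otimes> alg_unit B) \<cdot> f = f \<otimes> alg_unit B"
    if "f \<in> Arr C" "Cod C f = alg_obj A" for f
    using that Interchange[of f "\<one> (alg_obj A)" "\<one> K" "alg_unit B"] by simp
  then show ?thesis
    by (simp add: algebra_morphism_def Hom_iff tensor_algebra_mult_unbraided[OF A B] mult_unit[OF B]
      flip: Tensor_Ident)
qed

lemma algebra_morphism_tensor_right:
  assumes A: "is_algebra C A" and B: "is_algebra C B"
  shows "algebra_morphism C B (tensor_algebra C A B) (alg_unit A \<otimes> \<one> (alg_obj B))"
proof -
  note [simp] = algebra_simps[OF A] algebra_simps[OF B]
  have "(alg_unit A \<otimes> \<one> (alg_obj B)) \<cdot> f = alg_unit A \<otimes> f"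
    if "f \<in> Arr C" "Cod C f = alg_obj B" for f
    using that Interchange[of "\<one> K" "alg_unit A" f "\<one> (alg_obj B)"] by simp
  then show ?thesis
    by (simp add: algebra_morphism_def Hom_iff tensor_algebra_mult_unbraided[OF A B] mult_unit[OF A]
      flip: Tensor_Ident)
qed

text \<open>Reads a tensor product of arrows after a twist as a convolution, so that associativity
  and cancellation become available for it.\<close>

lemma conv_tensor_left_right:
  assumes A: "is_algebra C A" and B: "is_algebra C B" and D: "is_coalgebra C D"
    and [simp]: "M \<in> Obj C" "N \<in> Obj C" "f \<in> Arr C" "Dom C f = coalg_obj D \<otimes>\<^sub>o M" "Cod C f = alg_obj A"
    "g \<in> Arr C" "Dom C g = coalg_obj D \<otimes>\<^sub>o N" "Cod C g = alg_obj B"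
  shows "conv (tensor_algebra C A B) D M N
      ((\<one> (alg_obj A) \<otimes> alg_unit B) \<cdot> f) ((alg_unit A \<otimes> \<one> (alg_obj B)) \<cdot> g)
    = (f \<otimes> g) \<cdot> (twist D M \<otimes> \<one> N)"
proof -
  note [simp] = algebra_simps[OF A] algebra_simps[OF B] coalgebra_simps[OF D] twist_simps[OF D]
    tensor_algebra_mult_simps[OF A B]
  have "(\<one> (alg_obj A) \<otimes> alg_unit B) \<cdot> f = f \<otimes> alg_unit B"
    using Interchange[of f "\<one> (alg_obj A)" "\<one> K" "alg_unit B"] by simp
  moreover have "(alg_unit A \<otimes> \<one> (alg_obj B)) \<cdot> g = alg_unit A \<otimes> g"
    using Interchange[of "\<one> K" "alg_unit A" g "\<one> (alg_obj B)"] by simp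
  ultimately show ?thesis
    by (simp add: conv_def tensor_algebra_mult_unbraided[OF A B] mult_unit[OF A] mult_unit[OF B]
      flip: Comp_assoc)
qed

text \<open>In this order the two values have to cross each other, which leaves a braiding. The star
  condition will later make the two orders agree for suitable arrows.\<close>

lemma conv_tensor_right_left:
  assumes A: "is_algebra C A" and B: "is_algebra C B" and D: "is_coalgebra C D"
    and [simp]: "M \<in> Obj C" "N \<in> Obj C" "f \<in> Arr C" "Dom C f = coalg_obj D \<otimes>\<^sub>o M" "Cod C f = alg_obj B"
    "g \<in> Arr C" "Dom C g = coalg_obj D \<otimes>\<^sub>o N" "Cod C g = alg_obj A"
  shows "conv (tensor_algebra C A B) D M N
      ((alg_unit A \<otimes> \<one> (alg_obj B)) \<cdot> f) ((\<one> (alg_obj A) \<otimes> alg_unit B) \<cdot> g)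
    = \<c> (alg_obj B) (alg_obj A) \<cdot> ((f \<otimes> g) \<cdot> (twist D M \<otimes> \<one> N))"
proof -
  let ?X = "alg_obj A" let ?Y = "alg_obj B"
  note [simp] = algebra_simps[OF A] algebra_simps[OF B] coalgebra_simps[OF D] twist_simps[OF D]
    tensor_algebra_mult_simps[OF A B]
  have "(alg_unit A \<otimes> \<one> ?Y) \<cdot> f = alg_unit A \<otimes> f"
    using Interchange[of "\<one> K" "alg_unit A" f "\<one> ?Y"] by simp
  moreover have "(\<one> ?X \<otimes> alg_unit B) \<cdot> g = g \<otimes> alg_unit B"
    using Interchange[of g "\<one> ?X" "\<one> K" "alg_unit B"] by simp
  moreover have "alg_mult (tensor_algebra C A B) \<cdot> (alg_unit A \<otimes> f \<otimes> g \<otimes> alg_unit B)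
      = \<c> ?Y ?X \<cdot> (f \<otimes> g)"
  proof -
    have "alg_unit A \<otimes> ((g \<otimes> f) \<cdot> \<c> (coalg_obj D \<otimes>\<^sub>o M) (coalg_obj D \<otimes>\<^sub>o N)) \<otimes> alg_unit B
      = (alg_unit A \<otimes> \<one> ?X \<otimes> \<one> ?Y \<otimes> alg_unit B) \<cdot> ((g \<otimes> f) \<cdot> \<c> (coalg_obj D \<otimes>\<^sub>o M) (coalg_obj D \<otimes>\<^sub>o N))"
      (is "_ \<otimes> ?h \<otimes> _ = _")
      using Interchange[of "\<one> K" "alg_unit A" "?h" "\<one> ?X \<otimes> \<one> ?Y \<otimes> alg_unit B"]
        Interchange[of ?h "\<one> ?X \<otimes> \<one> ?Y" "\<one> K" "alg_unit B"]
      by simp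
    moreover have "(alg_mult A \<otimes> alg_mult B) \<cdot> (alg_unit A \<otimes> \<one> ?X \<otimes> \<one> ?Y \<otimes> alg_unit B) = \<one> ?X \<otimes> \<one> ?Y"
      using Interchange[of "alg_unit A \<otimes> \<one> ?X" "alg_mult A" "\<one> ?Y \<otimes> alg_unit B" "alg_mult B"]
      by (simp add: mult_unit[OF A] mult_unit[OF B])
    ultimately show ?thesis
      by (simp add: tensor_algebra_mult[OF A B] Braid_natural flip: Comp_assoc)
  qed
  ultimately show ?thesis
    by (simp add: conv_def flip: Comp_assoc)
qed

section \<open>Hopf algebras and cancellation\<close>

lemma alg_of_sel [simp]:
  "alg_obj (alg_of X) = carr X" "alg_unit (alg_of X) = eta X" "alg_mult (alg_of X) = mu X"
  by (simp_all add: alg_of_def)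

lemma coalg_of_sel [simp]:
  "coalg_obj (coalg_of X) = carr X" "coalg_counit (coalg_of X) = eps X" "coalg_comult (coalg_of X) = delta X"
  by (simp_all add: coalg_of_def)

lemma hopf_algebraD:
  assumes "hopf_algebra C X"
  shows "is_algebra C (alg_of X)" "is_coalgebra C (coalg_of X)"
    "algebra_morphism C (alg_of X) (unit_algebra C) (eps X)"
    "algebra_morphism C (alg_of X) (tensor_algebra C (alg_of X) (alg_of X)) (delta X)"
    "lam X \<in> Hom (carr X) (carr X)"
    "mu X \<cdot> (lam X \<otimes> \<one> (carr X)) \<cdot> delta X = eta X \<cdot> eps X"
    "mu X \<cdot> (\<one> (carr X) \<otimes> lam X) \<cdot> delta X = eta X \<cdot> eps X"
  using assms unfolding hopf_algebra_def by simp_all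

lemma hopf_simps [simp]:
  assumes "hopf_algebra C X"
  shows "carr X \<in> Obj C"
    "eta X \<in> Arr C" "Dom C (eta X) = K" "Cod C (eta X) = carr X"
    "mu X \<in> Arr C" "Dom C (mu X) = carr X \<otimes>\<^sub>o carr X" "Cod C (mu X) = carr X"
    "eps X \<in> Arr C" "Dom C (eps X) = carr X" "Cod C (eps X) = K"
    "delta X \<in> Arr C" "Dom C (delta X) = carr X" "Cod C (delta X) = carr X \<otimes>\<^sub>o carr X"
    "lam X \<in> Arr C" "Dom C (lam X) = carr X" "Cod C (lam X) = carr X"
  using algebra_simps[OF hopf_algebraD(1)[OF assms]] coalgebra_simps[OF hopf_algebraD(2)[OF assms]]
    hopf_algebraD(5)[OF assms]
  by (simp_all add: Hom_iff)

declare hopf_algebraD(1,2) [simp]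

lemma is_algebra_unit: "is_algebra C (unit_algebra C)"
  by (simp add: is_algebra_def unit_algebra_def Hom_iff)

section \<open>Morphisms of algebras, coalgebras and Hopf algebras\<close>

lemma algebra_morphism_Ident: "is_algebra C A \<Longrightarrow> algebra_morphism C A A (\<one> (alg_obj A))"
  by (simp add: algebra_morphism_def Hom_iff)

lemma coalgebra_morphism_Ident: "is_coalgebra C D \<Longrightarrow> coalgebra_morphism C D D (\<one> (coalg_obj D))"
  by (simp add: coalgebra_morphism_def Hom_iff)

lemma algebra_morphism_Comp:
  assumes "is_algebra C A" "is_algebra C A'" "is_algebra C A''"
    and f: "algebra_morphism C A A' f" and g: "algebra_morphism C A' A'' g"
  shows "algebra_morphism C A A'' (g \<cdot> f)"
proof -
  note [simp] = algebra_simps[OF assms(1)] algebra_simps[OF assms(2)] algebra_simps[OF assms(3)]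
  have [simp]: "f \<in> Arr C" "Dom C f = alg_obj A" "Cod C f = alg_obj A'"
    "g \<in> Arr C" "Dom C g = alg_obj A'" "Cod C g = alg_obj A''"
    using f g by (simp_all add: algebra_morphism_def Hom_iff)
  have "(g \<cdot> f) \<cdot> alg_mult A = (g \<cdot> alg_mult A') \<cdot> (f \<otimes> f)"
    using f by (simp add: algebra_morphism_def Comp_assoc)
  also have "\<dots> = alg_mult A'' \<cdot> ((g \<cdot> f) \<otimes> (g \<cdot> f))"
    using g by (simp add: algebra_morphism_def Comp_assoc Interchange)
  finally show ?thesis
    using f g by (simp add: algebra_morphism_def Hom_iff Comp_assoc)
qed

lemma coalgebra_morphism_Comp:
  assumes "is_coalgebra C D" "is_coalgebra C D'" "is_coalgebra C D''"
    and f: "coalgebra_morphism C D D' f" and g: "coalgebra_morphism C D' D'' g"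
  shows "coalgebra_morphism C D D'' (g \<cdot> f)"
proof -
  note [simp] = coalgebra_simps[OF assms(1)] coalgebra_simps[OF assms(2)] coalgebra_simps[OF assms(3)]
  have [simp]: "f \<in> Arr C" "Dom C f = coalg_obj D" "Cod C f = coalg_obj D'"
    "g \<in> Arr C" "Dom C g = coalg_obj D'" "Cod C g = coalg_obj D''"
    using f g by (simp_all add: coalgebra_morphism_def Hom_iff)
  have "coalg_comult D'' \<cdot> (g \<cdot> f) = (g \<otimes> g) \<cdot> (coalg_comult D' \<cdot> f)"
    using g by (simp add: coalgebra_morphism_def flip: Comp_assoc)
  also have "\<dots> = ((g \<cdot> f) \<otimes> (g \<cdot> f)) \<cdot> coalg_comult D"
    using f by (simp add: coalgebra_morphism_def Interchange_Comp)
  finally have 1: "coalg_comult D'' \<cdot> (g \<cdot> f) = ((g \<cdot> f) \<otimes> (g \<cdot> f)) \<cdot> coalg_comult D" .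
  have "coalg_counit D'' \<cdot> (g \<cdot> f) = coalg_counit D"
    using f g by (simp add: coalgebra_morphism_def flip: Comp_assoc)
  then show ?thesis
    using 1 by (simp add: coalgebra_morphism_def Hom_iff)
qed

lemma hopf_morphism_Ident: "hopf_algebra C X \<Longrightarrow> hopf_morphism C X X (\<one> (carr X))"
  using algebra_morphism_Ident[of "alg_of X"] coalgebra_morphism_Ident[of "coalg_of X"]
  by (simp add: hopf_morphism_def)

lemma hopf_morphism_Comp:
  assumes "hopf_algebra C X" "hopf_algebra C Y" "hopf_algebra C Z"
    and "hopf_morphism C X Y f" "hopf_morphism C Y Z g"
  shows "hopf_morphism C X Z (g \<cdot> f)"
  using assms algebra_morphism_Comp[of "alg_of X" "alg_of Y" "alg_of Z" f g]
    coalgebra_morphism_Comp[of "coalg_of X" "coalg_of Y" "coalg_of Z" f g]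
  by (simp add: hopf_morphism_def)

lemma hopf_morphism_simps:
  assumes "hopf_morphism C X Y f"
  shows "f \<in> Arr C" "Dom C f = carr X" "Cod C f = carr Y" "f \<cdot> eta X = eta Y"
  using assms by (simp_all add: hopf_morphism_def algebra_morphism_def Hom_iff)

text \<open>The bialgebra axioms are self-dual: multiplicativity of \<open>eps\<close> and
  \<open>delta\<close> gives the same equations, read as conditions on \<open>mu\<close>.\<close>

lemma coalgebra_morphism_mu:
  assumes H: "hopf_algebra C H"
  shows "coalgebra_morphism C (tensor_coalgebra C (coalg_of H) (coalg_of H)) (coalg_of H) (mu H)"
  using H hopf_algebraD(3,4)[OF H]
  by (simp add: algebra_morphism_def unit_algebra_def tensor_algebra_def
      coalgebra_morphism_def tensor_coalgebra_def Hom_iff Comp_assoc)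

lemma hopf_unit:
  assumes H: "hopf_algebra C H"
  shows "eps H \<cdot> eta H = \<one> K" "delta H \<cdot> eta H = eta H \<otimes> eta H"
  using hopf_algebraD(3,4)[OF H]
  by (simp_all add: algebra_morphism_def unit_algebra_def tensor_algebra_def)

text \<open>The antipode axioms are the case where \<open>p\<close> is the identity of
  \<open>B\<close>; \<open>conv_comp\<close> pulls them back along \<open>p\<close>.\<close>

lemma conv_antipode:
  assumes B: "hopf_algebra C B" and D: "is_coalgebra C D" and p: "coalgebra_morphism C D (coalg_of B) p"
  shows "conv (alg_of B) D K K (lam B \<cdot> p) p = eta B \<cdot> coalg_counit D"
    and "conv (alg_of B) D K K p (lam B \<cdot> p) = eta B \<cdot> coalg_counit D"
proof -
  note [simp] = coalgebra_simps[OF D] hopf_simps[OF B]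
  have [simp]: "p \<in> Arr C" "Dom C p = coalg_obj D" "Cod C p = carr B"
    and e: "eps B \<cdot> p = coalg_counit D"
    using p by (simp_all add: coalgebra_morphism_def Hom_iff)
  have A: "is_algebra C (alg_of B)" and D': "is_coalgebra C (coalg_of B)"
    using B by simp_all
  have "conv (alg_of B) (coalg_of B) K K (lam B) (\<one> (carr B)) = eta B \<cdot> eps B"
    "conv (alg_of B) (coalg_of B) K K (\<one> (carr B)) (lam B) = eta B \<cdot> eps B"
    using hopf_algebraD(6,7)[OF B] by (simp_all add: conv_def twist_unit[OF D'] Comp_assoc)
  then show "conv (alg_of B) D K K (lam B \<cdot> p) p = eta B \<cdot> coalg_counit D"
    and "conv (alg_of B) D K K p (lam B \<cdot> p) = eta B \<cdot> coalg_counit D"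
    using conv_comp[OF A D D' p, of "\<one> K" "\<one> K" "lam B" "\<one> (carr B)"]
      conv_comp[OF A D D' p, of "\<one> K" "\<one> K" "\<one> (carr B)" "lam B"]
    by (simp_all add: Comp_assoc e)
qed

text \<open>The algebra morphism \<open>w\<close> carries the convolution inverse of
  \<open>p\<close> to a left inverse \<open>w \<cdot> (lam B \<cdot> p)\<close> of
  \<open>w \<cdot> p\<close>.\<close>

lemma conv_left_cancel:
  assumes B: "hopf_algebra C B" and D: "is_coalgebra C D" and p: "coalgebra_morphism C D (coalg_of B) p"
    and A: "is_algebra C A" and w: "algebra_morphism C (alg_of B) A w" and [simp]: "N \<in> Obj C"
    and g [simp]: "g \<in> Arr C" "Dom C g = coalg_obj D \<otimes>\<^sub>o N" "Cod C g = alg_obj A"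
    and g' [simp]: "g' \<in> Arr C" "Dom C g' = coalg_obj D \<otimes>\<^sub>o N" "Cod C g' = alg_obj A"
    and eq: "conv A D K N (w \<cdot> p) g = conv A D K N (w \<cdot> p) g'"
  shows "g = g'"
proof -
  note [simp] = coalgebra_simps[OF D] hopf_simps[OF B] algebra_simps[OF A]
  have [simp]: "p \<in> Arr C" "Dom C p = coalg_obj D" "Cod C p = carr B"
    using p by (simp_all add: coalgebra_morphism_def Hom_iff)
  have [simp]: "w \<in> Arr C" "Dom C w = carr B" "Cod C w = alg_obj A" and wu: "w \<cdot> eta B = alg_unit A"
    using w by (simp_all add: algebra_morphism_def Hom_iff)
  have A': "is_algebra C (alg_of B)"
    using B by simp
  have "conv A D K K (w \<cdot> (lam B \<cdot> p)) (w \<cdot> p) = w \<cdot> (eta B \<cdot> coalg_counit D)"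
    using conv_algebra_morphism[OF A' A D w, of K K "lam B \<cdot> p" p] conv_antipode(1)[OF B D p]
    by simp
  also have "\<dots> = alg_unit A \<cdot> coalg_counit D"
    by (simp add: wu flip: Comp_assoc)
  finally have inv: "conv A D K K (w \<cdot> (lam B \<cdot> p)) (w \<cdot> p) = alg_unit A \<cdot> coalg_counit D" .
  have "conv A D K N (w \<cdot> (lam B \<cdot> p)) (conv A D K N (w \<cdot> p) g) = g"
    by (rule conv_cancel[OF A D]) (simp_all add: inv)
  moreover have "conv A D K N (w \<cdot> (lam B \<cdot> p)) (conv A D K N (w \<cdot> p) g') = g'"
    by (rule conv_cancel[OF A D]) (simp_all add: inv)
  ultimately show ?thesis
    unfolding eq by (rule trans[OF sym])
qed

text \<open>Translates the explicit composites in the module algebra and bracoid axioms into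
  convolutions.\<close>

lemma conv_expand:
  assumes A: "is_algebra C A" and D: "is_coalgebra C D"
    and [simp]: "M \<in> Obj C" "N \<in> Obj C" "f \<in> Arr C" "Dom C f = coalg_obj D \<otimes>\<^sub>o M" "Cod C f = alg_obj A"
    "g \<in> Arr C" "Dom C g = coalg_obj D \<otimes>\<^sub>o N" "Cod C g = alg_obj A"
  shows "alg_mult A \<cdot> (f \<otimes> g) \<cdot> (\<one> (coalg_obj D) \<otimes> \<c> (coalg_obj D) M \<otimes> \<one> N)
      \<cdot> (coalg_comult D \<otimes> \<one> M \<otimes> \<one> N) = conv A D M N f g"
proof -
  note [simp] = algebra_simps[OF A] coalgebra_simps[OF D]
  show ?thesis
    using Interchange[of "coalg_comult D \<otimes> \<one> M" "\<one> (coalg_obj D) \<otimes> \<c> (coalg_obj D) M" "\<one> N" "\<one> N"]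
    by (simp add: conv_def twist_def Comp_assoc)
qed

end

section \<open>Actions of the form \<open>\<pi> \<star> \<gamma>\<close>\<close>

locale hopf_pair = strict_braided_monoidal_category C
  for C :: "('o, 'm, 'z) braided_category_scheme" (structure) +
  fixes H B :: "('o, 'm) hopf"
  assumes H [simp]: "hopf_algebra C H" and B [simp]: "hopf_algebra C B"
begin

abbreviation HB :: "('o, 'm) coalgebra"
  where "HB \<equiv> tensor_coalgebra C (coalg_of H) (coalg_of B)"

abbreviation HH :: "('o, 'm) coalgebra"
  where "HH \<equiv> tensor_coalgebra C (coalg_of H) (coalg_of H)"

abbreviation BB :: "('o, 'm) algebra"
  where "BB \<equiv> tensor_algebra C (alg_of B) (alg_of B)"

abbreviation cnv :: "'o \<Rightarrow> 'o \<Rightarrow> 'm \<Rightarrow> 'm \<Rightarrow> 'm"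
  where "cnv \<equiv> conv (alg_of B) (coalg_of H)"

lemma HB_HH_BB: "is_coalgebra C HB" "is_coalgebra C HH" "is_algebra C BB"
  by (simp_all add: is_coalgebra_tensor is_algebra_tensor)

lemma cnv_eq:
  assumes "\<pi> \<in> Arr C" "Dom C \<pi> = carr H" "Cod C \<pi> = carr B"
    "f \<in> Arr C" "Dom C f = carr H \<otimes>\<^sub>o N" "Cod C f = carr B" "N \<in> Obj C"
  shows "cnv K N \<pi> f = mu B \<cdot> (\<pi> \<otimes> f) \<cdot> (delta H \<otimes> \<one> N)"
  using assms by (simp add: conv_def twist_unit Comp_assoc)

end

text \<open>Only the types and the comultiplicativity of \<open>\<pi>\<close> are fixed here, so
  that every axiom on \<open>\<gamma>\<close> can be compared with its counterpart on
  \<open>phi\<close> as an equivalence.\<close>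

locale hopf_pair_factorization = hopf_pair C H B
  for C :: "('o, 'm, 'z) braided_category_scheme" (structure) and H B +
  fixes \<pi> \<gamma> :: 'm
  assumes pi: "coalgebra_morphism C (coalg_of H) (coalg_of B) \<pi>"
    and gamma_hom: "\<gamma> \<in> Hom (carr H \<otimes>\<^sub>o carr B) (carr B)"
begin

definition phi :: 'm
  where "phi = cnv K (carr B) \<pi> \<gamma>"

lemma gamma_simps [simp]:
  "\<gamma> \<in> Arr C" "Dom C \<gamma> = carr H \<otimes>\<^sub>o carr B" "Cod C \<gamma> = carr B"
  using gamma_hom by (simp_all add: Hom_iff)

lemma pi_simps [simp]:
  "\<pi> \<in> Arr C" "Dom C \<pi> = carr H" "Cod C \<pi> = carr B"
  using pi by (simp_all add: coalgebra_morphism_def Hom_iff)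

lemma phi_simps [simp]:
  "phi \<in> Arr C" "Dom C phi = carr H \<otimes>\<^sub>o carr B" "Cod C phi = carr B"
  by (simp_all add: phi_def)

lemma cnv_pi_cancel:
  assumes "N \<in> Obj C" "f \<in> Arr C" "Dom C f = carr H \<otimes>\<^sub>o N" "Cod C f = carr B"
    "g \<in> Arr C" "Dom C g = carr H \<otimes>\<^sub>o N" "Cod C g = carr B"
  shows "cnv K N \<pi> f = cnv K N \<pi> g \<longleftrightarrow> f = g"
  using assms conv_left_cancel[OF B _ pi _ algebra_morphism_Ident, of N f g] by auto

lemma phi_Comp_right:
  assumes "n \<in> Arr C" "Cod C n = carr B"
  shows "phi \<cdot> (\<one> (carr H) \<otimes> n) = cnv K (Dom C n) \<pi> (\<gamma> \<cdot> (\<one> (carr H) \<otimes> n))"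
  using assms conv_comp[of "alg_of B" "coalg_of H" "coalg_of H" "\<one> (carr H)" "\<one> K" n \<pi> \<gamma>]
    coalgebra_morphism_Ident[of "coalg_of H"]
  by (simp add: phi_def)

text \<open>By associativity of convolution the first equation is the second one convolved with
  \<open>\<pi>\<close>. Once \<open>bracoid_Phi\<close> is known to be \<open>\<gamma>\<close>, the
  first one is the bracoid axiom.\<close>

lemma mult_iff:
  "phi \<cdot> (\<one> (carr H) \<otimes> mu B) = cnv (carr B) (carr B) phi \<gamma>
    \<longleftrightarrow> \<gamma> \<cdot> (\<one> (carr H) \<otimes> mu B) = cnv (carr B) (carr B) \<gamma> \<gamma>"
proof -
  have "cnv (carr B) (carr B) phi \<gamma> = cnv K (carr B \<otimes>\<^sub>o carr B) \<pi> (cnv (carr B) (carr B) \<gamma> \<gamma>)"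
    using conv_assoc[of "alg_of B" "coalg_of H" K "carr B" "carr B" \<pi> \<gamma> \<gamma>] by (simp add: phi_def)
  then show ?thesis
    by (simp add: phi_Comp_right cnv_pi_cancel)
qed

text \<open>The left side of the first equation is \<open>\<pi>\<close> convolved with
  \<open>\<gamma> \<cdot> (\<one> (carr H) \<otimes> eta B)\<close>, while \<open>\<pi>\<close> is
  its own convolution with the unit \<open>eta B \<cdot> eps H\<close>. So the unit axiom of a
  module algebra says that \<open>\<pi>\<close> is the arrow \<open>bracoid_u\<close> of
  \<open>phi\<close>.\<close>

lemma unit_iff:
  "phi \<cdot> (\<one> (carr H) \<otimes> eta B) = \<pi> \<longleftrightarrow> \<gamma> \<cdot> (\<one> (carr H) \<otimes> eta B) = eps H \<otimes> eta B"
proof -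
  have e: "eps H \<otimes> eta B = eta B \<cdot> eps H"
    using Interchange[of "eps H" "\<one> K" "\<one> K" "eta B"] by simp
  have "cnv K K \<pi> (eta B \<cdot> eps H) = mu B \<cdot> ((\<pi> \<otimes> (eta B \<cdot> eps H)) \<cdot> delta H)"
    by (simp add: conv_def twist_unit)
  also have "\<pi> \<otimes> (eta B \<cdot> eps H) = (\<pi> \<otimes> eta B) \<cdot> (\<one> (carr H) \<otimes> eps H)"
    by (simp add: Interchange)
  also have "mu B \<cdot> (\<dots> \<cdot> delta H) = (mu B \<cdot> (\<pi> \<otimes> eta B)) \<cdot> ((\<one> (carr H) \<otimes> eps H) \<cdot> delta H)"
    by (simp add: Comp_assoc)
  also have "\<dots> = \<pi>"
    using mult_unit(2)[of "alg_of B" \<pi>] hopf_algebraD(2)[OF H]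
    by (simp add: is_coalgebra_def Let_def)
  finally show ?thesis
    using cnv_pi_cancel[of K "\<gamma> \<cdot> (\<one> (carr H) \<otimes> eta B)" "eta B \<cdot> eps H"]
    by (simp add: phi_Comp_right e)
qed

text \<open>Hence the cocycle condition says that \<open>\<pi>\<close> intertwines left
  multiplication on \<open>H\<close> with \<open>phi\<close>.\<close>

lemma cocycle_eq:
  "mu B \<cdot> (\<pi> \<otimes> \<gamma>) \<cdot> (delta H \<otimes> \<pi>) = phi \<cdot> (\<one> (carr H) \<otimes> \<pi>)"
proof -
  have "phi \<cdot> (\<one> (carr H) \<otimes> \<pi>) = mu B \<cdot> ((\<pi> \<otimes> \<gamma>) \<cdot> ((delta H \<otimes> \<one> (carr B)) \<cdot> (\<one> (carr H) \<otimes> \<pi>)))"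
    by (simp add: phi_def conv_def twist_unit Comp_assoc)
  then show ?thesis
    by (simp add: Interchange Comp_assoc)
qed

text \<open>In Sweedler notation, acting twice by \<open>phi\<close> gives
  \<open>\<pi>(h1 k1) \<gamma>(h2 \<otimes> \<gamma>(k2 \<otimes> b))\<close>, and acting by the
  product gives \<open>\<pi>(h1 k1) \<gamma>(h2 k2 \<otimes> b)\<close>. These are convolutions over
  \<open>H \<otimes> H\<close> with the same cancellable left factor
  \<open>\<pi> \<cdot> mu H\<close>.\<close>

lemma module_mult_iff:
  assumes mult: "\<gamma> \<cdot> (\<one> (carr H) \<otimes> mu B) = cnv (carr B) (carr B) \<gamma> \<gamma>"
    and cocycle: "phi \<cdot> (\<one> (carr H) \<otimes> \<pi>) = \<pi> \<cdot> mu H"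
  shows "phi \<cdot> (\<one> (carr H) \<otimes> phi) = phi \<cdot> (mu H \<otimes> \<one> (carr B))
    \<longleftrightarrow> \<gamma> \<cdot> (\<one> (carr H) \<otimes> \<gamma>) = \<gamma> \<cdot> (mu H \<otimes> \<one> (carr B))"
proof -
  let ?H = "carr H" let ?B = "carr B"
  note [simp] = HB_HH_BB
  \<comment> \<open>Only the inner \<open>phi\<close> is expanded; its product is then distributed
    by the multiplicativity of the outer one.\<close>
  have "\<one> ?H \<otimes> phi = (\<one> ?H \<otimes> mu B) \<cdot> ((\<one> ?H \<otimes> \<pi> \<otimes> \<gamma>) \<cdot> (\<one> ?H \<otimes> delta H \<otimes> \<one> ?B))"
    by (simp add: phi_def conv_def twist_unit Interchange)
  then have "phi \<cdot> (\<one> ?H \<otimes> phi)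
      = (cnv ?B ?B phi \<gamma> \<cdot> (\<one> ?H \<otimes> \<pi> \<otimes> \<gamma>)) \<cdot> (\<one> ?H \<otimes> delta H \<otimes> \<one> ?B)"
    using mult mult_iff by (simp flip: Comp_assoc)
  also have "cnv ?B ?B phi \<gamma> \<cdot> (\<one> ?H \<otimes> \<pi> \<otimes> \<gamma>)
      = cnv ?H (?H \<otimes>\<^sub>o ?B) (\<pi> \<cdot> mu H) (\<gamma> \<cdot> (\<one> ?H \<otimes> \<gamma>))"
    using conv_comp[of "alg_of B" "coalg_of H" "coalg_of H" "\<one> ?H" \<pi> \<gamma> phi \<gamma>]
      coalgebra_morphism_Ident[of "coalg_of H"]
    by (simp add: cocycle)
  \<comment> \<open>Copying the second \<open>H\<close> and then twisting the first across one copy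
    is the comultiplication of \<open>HH\<close>, so the convolution now runs over
    \<open>H \<otimes> H\<close>.\<close>
  also have "\<dots> \<cdot> (\<one> ?H \<otimes> delta H \<otimes> \<one> ?B) = conv (alg_of B) HH K ?B (\<pi> \<cdot> mu H) (\<gamma> \<cdot> (\<one> ?H \<otimes> \<gamma>))"
    using Interchange[of "\<one> ?H \<otimes> delta H" "twist (coalg_of H) ?H \<otimes> \<one> ?H" "\<one> ?B" "\<one> ?B"]
    by (simp add: conv_def twist_unit[of HH] tensor_coalgebra_comult Comp_assoc Tensor_Ident)
  finally have l: "phi \<cdot> (\<one> ?H \<otimes> phi) = conv (alg_of B) HH K ?B (\<pi> \<cdot> mu H) (\<gamma> \<cdot> (\<one> ?H \<otimes> \<gamma>))" .
  have r: "phi \<cdot> (mu H \<otimes> \<one> ?B) = conv (alg_of B) HH K ?B (\<pi> \<cdot> mu H) (\<gamma> \<cdot> (mu H \<otimes> \<one> ?B))"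
    using conv_comp[of "alg_of B" HH "coalg_of H" "mu H" "\<one> K" "\<one> ?B" \<pi> \<gamma>] coalgebra_morphism_mu[of H]
    by (simp add: phi_def)
  have p: "coalgebra_morphism C HH (coalg_of B) (\<pi> \<cdot> mu H)"
    using coalgebra_morphism_mu[OF H] pi by (intro coalgebra_morphism_Comp[of HH "coalg_of H"]) simp_all
  show ?thesis
    unfolding l r
    using conv_left_cancel[OF B HB_HH_BB(2) p _ algebra_morphism_Ident, of ?B
        "\<gamma> \<cdot> (\<one> ?H \<otimes> \<gamma>)" "\<gamma> \<cdot> (mu H \<otimes> \<one> ?B)"]
    by auto
qed

text \<open>The unit of \<open>H\<close> is grouplike, so at it the convolution is a plain product
  with left factor \<open>\<pi> \<cdot> eta H\<close>, the unit of \<open>B\<close>.\<close>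

lemma phi_module_unit:
  assumes "\<pi> \<cdot> eta H = eta B"
  shows "phi \<cdot> (eta H \<otimes> \<one> (carr B)) = \<gamma> \<cdot> (eta H \<otimes> \<one> (carr B))"
proof -
  have "(delta H \<otimes> \<one> (carr B)) \<cdot> (eta H \<otimes> \<one> (carr B)) = eta H \<otimes> eta H \<otimes> \<one> (carr B)"
    by (simp add: Interchange hopf_unit)
  then have "phi \<cdot> (eta H \<otimes> \<one> (carr B)) = mu B \<cdot> ((\<pi> \<otimes> \<gamma>) \<cdot> (eta H \<otimes> eta H \<otimes> \<one> (carr B)))"
    by (simp add: phi_def conv_def twist_unit Comp_assoc)
  also have "\<dots> = mu B \<cdot> (eta B \<otimes> (\<gamma> \<cdot> (eta H \<otimes> \<one> (carr B))))"
    by (simp add: Interchange assms)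
  also have "\<dots> = \<gamma> \<cdot> (eta H \<otimes> \<one> (carr B))"
    using mult_unit(1)[of "alg_of B" "\<gamma> \<cdot> (eta H \<otimes> \<one> (carr B))"] by simp
  finally show ?thesis .
qed

text \<open>The arrow \<open>\<pi> \<eta>\<^sub>H\<close> is grouplike, hence invertible, and the cocycle condition makes it
  idempotent.\<close>

lemma pi_eta:
  assumes cocycle: "phi \<cdot> (\<one> (carr H) \<otimes> \<pi>) = \<pi> \<cdot> mu H"
    and unit: "\<gamma> \<cdot> (eta H \<otimes> \<one> (carr B)) = \<one> (carr B)"
  shows "\<pi> \<cdot> eta H = eta B"
proof -
  define g where "g = \<pi> \<cdot> eta H"
  have [simp]: "g \<in> Arr C" "Dom C g = K" "Cod C g = carr B"
    by (simp_all add: g_def)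
  have A: "is_algebra C (alg_of B)" by simp
  have m: "mu B \<cdot> (mu B \<otimes> \<one> (carr B)) = mu B \<cdot> (\<one> (carr B) \<otimes> mu B)"
    using A by (simp add: is_algebra_def Let_def)
  have gg: "mu B \<cdot> (g \<otimes> g) = g"
  proof -
    have "\<gamma> \<cdot> (eta H \<otimes> g) = (\<gamma> \<cdot> (eta H \<otimes> \<one> (carr B))) \<cdot> g"
      using Interchange[of "\<one> K" "eta H" g "\<one> (carr B)"] by (simp add: Comp_assoc)
    then have gm: "\<gamma> \<cdot> (eta H \<otimes> g) = g"
      by (simp add: unit)
    have "g = \<pi> \<cdot> mu H \<cdot> (eta H \<otimes> eta H)"
      using mult_unit(1)[of "alg_of H" "eta H"] by (simp add: g_def Comp_assoc)
    also have "\<dots> = mu B \<cdot> ((\<pi> \<otimes> \<gamma>) \<cdot> ((delta H \<otimes> \<pi>) \<cdot> (eta H \<otimes> eta H)))"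
      by (simp add: cocycle_eq[symmetric] Comp_assoc flip: cocycle)
    also have "\<dots> = mu B \<cdot> (g \<otimes> (\<gamma> \<cdot> (eta H \<otimes> g)))"
      by (simp add: Interchange hopf_unit g_def)
    finally show ?thesis
      by (simp add: gm)
  qed
  have "delta B \<cdot> g = g \<otimes> g" and "eps B \<cdot> g = \<one> K"
  proof -
    have "delta B \<cdot> g = (\<pi> \<otimes> \<pi>) \<cdot> (delta H \<cdot> eta H)"
      using pi by (simp add: coalgebra_morphism_def g_def flip: Comp_assoc)
    then show "delta B \<cdot> g = g \<otimes> g"
      by (simp add: hopf_unit Interchange g_def)
    show "eps B \<cdot> g = \<one> K"
      using pi by (simp add: coalgebra_morphism_def g_def hopf_unit flip: Comp_assoc)
  qed
  have "mu B \<cdot> ((lam B \<cdot> g) \<otimes> g) = mu B \<cdot> ((lam B \<otimes> \<one> (carr B)) \<cdot> (delta B \<cdot> g))"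
    by (simp add: \<open>delta B \<cdot> g = g \<otimes> g\<close> Interchange)
  also have "\<dots> = (mu B \<cdot> (lam B \<otimes> \<one> (carr B)) \<cdot> delta B) \<cdot> g"
    by (simp add: Comp_assoc)
  also have "\<dots> = eta B"
    by (simp add: hopf_algebraD(6)[OF B] Comp_assoc \<open>eps B \<cdot> g = \<one> K\<close>)
  finally have inv: "mu B \<cdot> ((lam B \<cdot> g) \<otimes> g) = eta B" .
  \<comment> \<open>The product of \<open>lam B \<cdot> g\<close>, \<open>g\<close> and
    \<open>g\<close> is bracketed in two ways: one gives \<open>g\<close>, the other, by
    idempotence, the product of \<open>lam B \<cdot> g\<close> and \<open>g\<close>, which is
    \<open>eta B\<close>.\<close>
  have "g = mu B \<cdot> ((mu B \<cdot> ((lam B \<cdot> g) \<otimes> g)) \<otimes> g)"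
    using mult_unit(1)[OF A, of g] by (simp add: inv)
  also have "\<dots> = (mu B \<cdot> (mu B \<otimes> \<one> (carr B))) \<cdot> ((lam B \<cdot> g) \<otimes> g \<otimes> g)"
    using Interchange[of "(lam B \<cdot> g) \<otimes> g" "mu B" g "\<one> (carr B)"] by (simp add: Comp_assoc)
  also have "\<dots> = mu B \<cdot> ((lam B \<cdot> g) \<otimes> g)"
    unfolding m by (simp add: Comp_assoc Interchange gg)
  finally show ?thesis
    unfolding g_def[symmetric] using inv by (rule trans)
qed

text \<open>The star condition inserts a braiding of \<open>H\<close> with \<open>H\<close>.
  Together with the one in the twist it forms the braiding of \<open>H\<close> with
  \<open>H \<otimes> B\<close>, which naturality moves behind
  \<open>\<pi> \<otimes> \<gamma>\<close>; \<open>conv_tensor_right_left\<close> recognizes the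
  convolution in the opposite order.\<close>

lemma star_swap:
  assumes star: "star_condition C H B \<gamma>"
  shows "conv BB (coalg_of H) (carr B) K
      ((\<one> (carr B) \<otimes> eta B) \<cdot> \<gamma>) ((eta B \<otimes> \<one> (carr B)) \<cdot> \<pi>)
    = conv BB (coalg_of H) K (carr B) ((eta B \<otimes> \<one> (carr B)) \<cdot> \<pi>) ((\<one> (carr B) \<otimes> eta B) \<cdot> \<gamma>)"
proof -
  let ?H = "carr H" let ?B = "carr B"
  have gp: "\<gamma> \<otimes> \<pi> = (\<one> ?B \<otimes> \<pi>) \<cdot> (\<gamma> \<otimes> \<one> ?H)"
    by (simp add: Interchange)
  have "conv BB (coalg_of H) ?B K ((\<one> ?B \<otimes> eta B) \<cdot> \<gamma>) ((eta B \<otimes> \<one> ?B) \<cdot> \<pi>)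
      = (\<gamma> \<otimes> \<pi>) \<cdot> twist (coalg_of H) ?B"
    using conv_tensor_left_right[of "alg_of B" "alg_of B" "coalg_of H" ?B K \<gamma> \<pi>] by simp
  also have "\<dots> = (\<one> ?B \<otimes> \<pi>) \<cdot> ((\<gamma> \<otimes> \<one> ?H) \<cdot> (\<one> ?H \<otimes> \<c> ?H ?B) \<cdot> (delta H \<otimes> \<one> ?B))"
    by (simp add: gp twist_def Comp_assoc)
  also have "\<dots> = (\<one> ?B \<otimes> \<pi>) \<cdot> ((\<gamma> \<otimes> \<one> ?H) \<cdot> (\<one> ?H \<otimes> \<c> ?H ?B) \<cdot> ((\<c> ?H ?H \<cdot> delta H) \<otimes> \<one> ?B))"
    using star by (simp add: star_condition_def)
  also have "(\<c> ?H ?H \<cdot> delta H) \<otimes> \<one> ?B = (\<c> ?H ?H \<otimes> \<one> ?B) \<cdot> (delta H \<otimes> \<one> ?B)"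
    by (simp add: Interchange)
  also have "(\<one> ?B \<otimes> \<pi>) \<cdot> ((\<gamma> \<otimes> \<one> ?H) \<cdot> (\<one> ?H \<otimes> \<c> ?H ?B) \<cdot> ((\<c> ?H ?H \<otimes> \<one> ?B) \<cdot> (delta H \<otimes> \<one> ?B)))
     = ((\<gamma> \<otimes> \<pi>) \<cdot> \<c> ?H (?H \<otimes>\<^sub>o ?B)) \<cdot> (delta H \<otimes> \<one> ?B)"
    by (simp add: gp hexagon1 Comp_assoc)
  also have "(\<gamma> \<otimes> \<pi>) \<cdot> \<c> ?H (?H \<otimes>\<^sub>o ?B) = \<c> ?B ?B \<cdot> (\<pi> \<otimes> \<gamma>)"
    by (simp add: Braid_natural)
  also have "(\<c> ?B ?B \<cdot> (\<pi> \<otimes> \<gamma>)) \<cdot> (delta H \<otimes> \<one> ?B)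
      = conv BB (coalg_of H) K ?B ((eta B \<otimes> \<one> ?B) \<cdot> \<pi>) ((\<one> ?B \<otimes> eta B) \<cdot> \<gamma>)"
    using conv_tensor_right_left[of "alg_of B" "alg_of B" "coalg_of H" K ?B \<pi> \<gamma>]
    by (simp add: twist_unit Comp_assoc)
  finally show ?thesis .
qed

text \<open>For the algebra embeddings \<open>l, r : B \<rightarrow> B \<otimes> B\<close> into the two factors, \<open>\<phi> \<otimes> \<phi>\<close> becomes
  \<open>l\<pi> \<star> l\<gamma> \<star> r\<pi> \<star> r\<gamma>\<close>. The star condition is what exchanges the two middle terms.\<close>

lemma phi_tensor_phi:
  assumes star: "star_condition C H B \<gamma>"
  shows "(phi \<otimes> phi) \<cdot> coalg_comult HB
    = conv BB (coalg_of H) K (carr B) (delta B \<cdot> \<pi>) ((\<gamma> \<otimes> \<gamma>) \<cdot> coalg_comult HB)"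
proof -
  let ?H = "carr H" let ?B = "carr B"
  let ?l = "\<one> ?B \<otimes> eta B" let ?r = "eta B \<otimes> \<one> ?B"
  let ?cv = "conv BB (coalg_of H)"
  note [simp] = HB_HH_BB
  have A: "is_algebra C (alg_of B)" and D: "is_coalgebra C (coalg_of H)"
    by simp_all
  have l: "?l \<cdot> phi = ?cv K ?B (?l \<cdot> \<pi>) (?l \<cdot> \<gamma>)" and r: "?r \<cdot> phi = ?cv K ?B (?r \<cdot> \<pi>) (?r \<cdot> \<gamma>)"
    using conv_algebra_morphism[OF A HB_HH_BB(3) D algebra_morphism_tensor_left[OF A A], of K ?B \<pi> \<gamma>]
      conv_algebra_morphism[OF A HB_HH_BB(3) D algebra_morphism_tensor_right[OF A A], of K ?B \<pi> \<gamma>]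
    by (simp_all add: phi_def)
  \<comment> \<open>Here the comultiplicativity of \<open>\<pi>\<close> enters: its images in the
    two factors recombine to \<open>delta B \<cdot> \<pi>\<close>.\<close>
  have pp: "?cv K K (?l \<cdot> \<pi>) (?r \<cdot> \<pi>) = delta B \<cdot> \<pi>"
    using conv_tensor_left_right[OF A A D, of K K \<pi> \<pi>] pi
    by (simp add: twist_unit coalgebra_morphism_def)
  have gg: "?cv ?B ?B (?l \<cdot> \<gamma>) (?r \<cdot> \<gamma>) = (\<gamma> \<otimes> \<gamma>) \<cdot> (twist (coalg_of H) ?B \<otimes> \<one> ?B)"
    using conv_tensor_left_right[OF A A D, of ?B ?B \<gamma> \<gamma>] by simp
  have "(phi \<otimes> phi) \<cdot> (twist (coalg_of H) ?B \<otimes> \<one> ?B) = ?cv ?B ?B (?l \<cdot> phi) (?r \<cdot> phi)"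
    using conv_tensor_left_right[OF A A D, of ?B ?B phi phi] by simp
  also have "\<dots> = ?cv K (?B \<otimes>\<^sub>o ?B) (?l \<cdot> \<pi>) (?cv ?B ?B (?l \<cdot> \<gamma>) (?cv K ?B (?r \<cdot> \<pi>) (?r \<cdot> \<gamma>)))"
    unfolding l r
    using conv_assoc[OF HB_HH_BB(3) D, of K ?B ?B "?l \<cdot> \<pi>" "?l \<cdot> \<gamma>" "?cv K ?B (?r \<cdot> \<pi>) (?r \<cdot> \<gamma>)"] by simp
  also have "?cv ?B ?B (?l \<cdot> \<gamma>) (?cv K ?B (?r \<cdot> \<pi>) (?r \<cdot> \<gamma>))
      = ?cv ?B ?B (?cv ?B K (?l \<cdot> \<gamma>) (?r \<cdot> \<pi>)) (?r \<cdot> \<gamma>)"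
    using conv_assoc[OF HB_HH_BB(3) D, of ?B K ?B "?l \<cdot> \<gamma>" "?r \<cdot> \<pi>" "?r \<cdot> \<gamma>"] by simp
  also have "\<dots> = ?cv K (?B \<otimes>\<^sub>o ?B) (?r \<cdot> \<pi>) (?cv ?B ?B (?l \<cdot> \<gamma>) (?r \<cdot> \<gamma>))"
    unfolding star_swap[OF star]
    using conv_assoc[OF HB_HH_BB(3) D, of K ?B ?B "?r \<cdot> \<pi>" "?l \<cdot> \<gamma>" "?r \<cdot> \<gamma>"] by simp
  also have "?cv K (?B \<otimes>\<^sub>o ?B) (?l \<cdot> \<pi>) \<dots>
      = ?cv K (?B \<otimes>\<^sub>o ?B) (?cv K K (?l \<cdot> \<pi>) (?r \<cdot> \<pi>)) (?cv ?B ?B (?l \<cdot> \<gamma>) (?r \<cdot> \<gamma>))"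
    using conv_assoc[OF HB_HH_BB(3) D, of K K "?B \<otimes>\<^sub>o ?B" "?l \<cdot> \<pi>" "?r \<cdot> \<pi>" "?cv ?B ?B (?l \<cdot> \<gamma>) (?r \<cdot> \<gamma>)"]
    by simp
  finally have "(phi \<otimes> phi) \<cdot> coalg_comult HB
      = ?cv K (?B \<otimes>\<^sub>o ?B) (delta B \<cdot> \<pi>) ((\<gamma> \<otimes> \<gamma>) \<cdot> (twist (coalg_of H) ?B \<otimes> \<one> ?B)) \<cdot> (\<one> ?H \<otimes> delta B)"
    unfolding pp gg by (simp add: tensor_coalgebra_comult flip: Comp_assoc)
  \<comment> \<open>Up to here the two actions had independent arguments in
    \<open>B \<otimes> B\<close>. Substituting \<open>delta B\<close> for that parameter completes
    the comultiplication of \<open>HB\<close>.\<close>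
  also have "\<dots> = ?cv K ?B (delta B \<cdot> \<pi>) ((\<gamma> \<otimes> \<gamma>) \<cdot> coalg_comult HB)"
    using conv_comp[OF HB_HH_BB(3) D D, of "\<one> ?H" "\<one> K" "delta B" "delta B \<cdot> \<pi>"
        "(\<gamma> \<otimes> \<gamma>) \<cdot> (twist (coalg_of H) ?B \<otimes> \<one> ?B)"] coalgebra_morphism_Ident[OF D]
    by (simp add: tensor_coalgebra_comult Comp_assoc)
  finally show ?thesis .
qed

text \<open>As \<open>delta B\<close> is multiplicative, \<open>delta B \<cdot> phi\<close> has the
  left factor \<open>delta B \<cdot> \<pi>\<close>, the same as in \<open>phi_tensor_phi\<close>,
  and it cancels. For counits, \<open>eps B \<cdot> \<pi>\<close> is the convolution unit, so
  \<open>phi\<close> and \<open>\<gamma>\<close> agree after \<open>eps B\<close>.\<close>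

lemma coalgebra_morphism_iff:
  assumes star: "star_condition C H B \<gamma>"
  shows "coalgebra_morphism C HB (coalg_of B) phi \<longleftrightarrow> coalgebra_morphism C HB (coalg_of B) \<gamma>"
proof -
  let ?B = "carr B"
  note [simp] = HB_HH_BB
  have A: "is_algebra C (alg_of B)" and D: "is_coalgebra C (coalg_of H)"
    by simp_all
  have "delta B \<cdot> phi = conv BB (coalg_of H) K ?B (delta B \<cdot> \<pi>) (delta B \<cdot> \<gamma>)"
    using conv_algebra_morphism[OF A HB_HH_BB(3) D hopf_algebraD(4)[OF B], of K ?B \<pi> \<gamma>]
    by (simp add: phi_def)
  then have comult: "delta B \<cdot> phi = (phi \<otimes> phi) \<cdot> coalg_comult HB
      \<longleftrightarrow> delta B \<cdot> \<gamma> = (\<gamma> \<otimes> \<gamma>) \<cdot> coalg_comult HB"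
    using conv_left_cancel[OF B D pi HB_HH_BB(3) hopf_algebraD(4)[OF B], of ?B "delta B \<cdot> \<gamma>"
        "(\<gamma> \<otimes> \<gamma>) \<cdot> coalg_comult HB"] coalgebra_simps[OF HB_HH_BB(1)]
    by (auto simp: phi_tensor_phi[OF star])
  have "eps B \<cdot> phi = conv (unit_algebra C) (coalg_of H) K ?B (eps B \<cdot> \<pi>) (eps B \<cdot> \<gamma>)"
    using conv_algebra_morphism[OF A is_algebra_unit D hopf_algebraD(3)[OF B], of K ?B \<pi> \<gamma>]
    by (simp add: phi_def)
  also have "eps B \<cdot> \<pi> = alg_unit (unit_algebra C) \<cdot> coalg_counit (coalg_of H)"
    using pi by (simp add: coalgebra_morphism_def unit_algebra_def)
  finally have "eps B \<cdot> phi = eps B \<cdot> \<gamma>"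
    using conv_unit_left[OF is_algebra_unit D, of ?B "eps B \<cdot> \<gamma>"] by (simp add: unit_algebra_def)
  then show ?thesis
    using comult by (simp add: coalgebra_morphism_def Hom_iff)
qed

section \<open>The bracoid and the cocycle built from the same data\<close>

abbreviation bracoid :: "('o, 'm) bracoid"
  where "bracoid \<equiv> \<lparr>br_H = H, br_B = B, br_phi = phi\<rparr>"

abbreviation cocycle :: "('o, 'm) cocycle"
  where "cocycle \<equiv> \<lparr>cc_H = H, cc_B = B, cc_gamma = \<gamma>, cc_pi = \<pi>\<rparr>"

text \<open>With \<open>\<pi>\<close> in place of \<open>bracoid_u\<close>, the definition of
  \<open>bracoid_Phi\<close> convolves \<open>phi\<close> with the inverse of \<open>\<pi>\<close>,
  which undoes the construction of \<open>phi\<close>.\<close>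

lemma bracoid_Phi_eq:
  assumes "bracoid_u C bracoid = \<pi>"
  shows "bracoid_Phi C bracoid = \<gamma>"
proof -
  have A: "is_algebra C (alg_of B)" and D: "is_coalgebra C (coalg_of H)"
    by simp_all
  have "bracoid_Phi C bracoid = cnv K (carr B) (lam B \<cdot> \<pi>) phi"
    by (simp add: bracoid_Phi_def assms cnv_eq)
  also have "\<dots> = \<gamma>"
    unfolding phi_def
    by (rule conv_cancel[OF A D]) (use conv_antipode(1)[OF B D pi] in simp_all)
  finally show ?thesis .
qed

text \<open>The axioms are matched one by one; \<open>bracoid_u C bracoid = \<pi>\<close> answers to
  the unit axiom of a module algebra. The cocycle condition is not listed among the bracoid axioms
  and has to be derived from the action.\<close>

lemma cocycle_iff_bracoid:
  assumes star: "star_condition C H B \<gamma>"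
  shows "one_cocycle C cocycle \<and> coalgebra_morphism C HB (coalg_of B) \<gamma>
    \<longleftrightarrow> hopf_bracoid C bracoid \<and> coalgebra_morphism C HB (coalg_of B) phi \<and> bracoid_u C bracoid = \<pi>"
    (is "?cocycle \<longleftrightarrow> ?bracoid")
proof -
  let ?H = "carr H" let ?B = "carr B"
  define mod_unit where "mod_unit f \<longleftrightarrow> f \<cdot> (eta H \<otimes> \<one> ?B) = \<one> ?B" for f
  define mod_mult where "mod_mult f \<longleftrightarrow> f \<cdot> (\<one> ?H \<otimes> f) = f \<cdot> (mu H \<otimes> \<one> ?B)" for f
  \<comment> \<open>The second factor is \<open>\<gamma>\<close> for either \<open>f\<close>, so
    \<open>alg_mult \<gamma>\<close> is the module algebra axiom and \<open>alg_mult phi\<close> the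
    bracoid axiom with \<open>bracoid_Phi\<close> replaced by \<open>\<gamma>\<close>.\<close>
  define alg_mult where "alg_mult f \<longleftrightarrow> f \<cdot> (\<one> ?H \<otimes> mu B) = cnv ?B ?B f \<gamma>" for f
  define cocyc where "cocyc \<longleftrightarrow> phi \<cdot> (\<one> ?H \<otimes> \<pi>) = \<pi> \<cdot> mu H"
  have u: "bracoid_u C bracoid = phi \<cdot> (\<one> ?H \<otimes> eta B)"
    by (simp add: bracoid_u_def)
  have 1: "?cocycle \<longleftrightarrow> mod_unit \<gamma> \<and> mod_mult \<gamma> \<and> bracoid_u C bracoid = \<pi> \<and> alg_mult \<gamma> \<and> cocyc
      \<and> coalgebra_morphism C HB (coalg_of B) phi"
    using conv_expand[of "alg_of B" "coalg_of H" ?B ?B \<gamma> \<gamma>] pi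
    by (auto simp: one_cocycle_def left_module_algebra_def left_module_def Hom_iff cocycle_eq
        coalgebra_morphism_iff[OF star] mod_unit_def mod_mult_def alg_mult_def cocyc_def u unit_iff)
  have 2: "?bracoid \<longleftrightarrow> mod_unit phi \<and> mod_mult phi \<and> alg_mult phi \<and> bracoid_u C bracoid = \<pi>
      \<and> coalgebra_morphism C HB (coalg_of B) phi"
  proof -
    have "mu B \<cdot> (phi \<otimes> \<gamma>) \<cdot> (\<one> ?H \<otimes> \<c> ?H ?B \<otimes> \<one> ?B) \<cdot> (delta H \<otimes> \<one> ?B \<otimes> \<one> ?B) = cnv ?B ?B phi \<gamma>"
      using conv_expand[of "alg_of B" "coalg_of H" ?B ?B phi \<gamma>] by simp
    then have "hopf_bracoid C bracoid \<longleftrightarrow> mod_unit phi \<and> mod_mult phi \<and> alg_mult phi"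
      if "bracoid_u C bracoid = \<pi>"
      by (simp add: hopf_bracoid_def Let_def left_module_def Hom_iff bracoid_Phi_eq[OF that]
          mod_unit_def mod_mult_def alg_mult_def)
    then show ?thesis by blast
  qed
  have alg: "alg_mult phi \<longleftrightarrow> alg_mult \<gamma>"
    unfolding alg_mult_def by (rule mult_iff)
  have mod: "mod_mult phi \<longleftrightarrow> mod_mult \<gamma>" if "alg_mult \<gamma>" cocyc
    using that unfolding alg_mult_def cocyc_def mod_mult_def by (rule module_mult_iff)
  have unit: "mod_unit phi \<longleftrightarrow> mod_unit \<gamma>" if "\<pi> \<cdot> eta H = eta B"
    unfolding mod_unit_def by (simp add: phi_module_unit[OF that])
  \<comment> \<open>Associativity of \<open>phi\<close> evaluated at the unit of \<open>B\<close>,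
    where \<open>phi\<close> becomes \<open>\<pi>\<close>.\<close>
  have cocyc: cocyc if m: "mod_mult phi" and "bracoid_u C bracoid = \<pi>"
  proof -
    have pu: "phi \<cdot> (\<one> ?H \<otimes> eta B) = \<pi>"
      using that u by simp
    have "phi \<cdot> (\<one> ?H \<otimes> \<pi>) = (phi \<cdot> (\<one> ?H \<otimes> phi)) \<cdot> (\<one> (?H \<otimes>\<^sub>o ?H) \<otimes> eta B)"
      by (simp add: Comp_assoc Interchange Tensor_Ident pu)
    also have "\<dots> = phi \<cdot> ((mu H \<otimes> \<one> ?B) \<cdot> (\<one> (?H \<otimes>\<^sub>o ?H) \<otimes> eta B))"
      using m by (simp add: mod_mult_def Comp_assoc)
    also have "(mu H \<otimes> \<one> ?B) \<cdot> (\<one> (?H \<otimes>\<^sub>o ?H) \<otimes> eta B) = (\<one> ?H \<otimes> eta B) \<cdot> mu H"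
      using Interchange[of "mu H" "\<one> ?H" "\<one> K" "eta B"] by (simp add: Interchange)
    also have "phi \<cdot> \<dots> = (phi \<cdot> (\<one> ?H \<otimes> eta B)) \<cdot> mu H"
      by (simp add: Comp_assoc)
    finally show ?thesis
      unfolding cocyc_def pu .
  qed
  \<comment> \<open>On the bracoid side this is the unit law of the action at the unit of
    \<open>B\<close>; on the cocycle side it comes from \<open>pi_eta\<close>.\<close>
  have eta: "\<pi> \<cdot> eta H = eta B" if m: "mod_unit phi" and "bracoid_u C bracoid = \<pi>"
  proof -
    have pu: "phi \<cdot> (\<one> ?H \<otimes> eta B) = \<pi>"
      using that u by simp
    have "\<pi> \<cdot> eta H = phi \<cdot> ((\<one> ?H \<otimes> eta B) \<cdot> (eta H \<otimes> \<one> K))"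
      by (simp add: pu flip: Comp_assoc)
    also have "(\<one> ?H \<otimes> eta B) \<cdot> (eta H \<otimes> \<one> K) = (eta H \<otimes> \<one> ?B) \<cdot> eta B"
      using Interchange[of "\<one> K" "eta H" "eta B" "\<one> ?B"] Interchange[of "eta H" "\<one> ?H" "\<one> K" "eta B"]
      by simp
    also have "phi \<cdot> \<dots> = (phi \<cdot> (eta H \<otimes> \<one> ?B)) \<cdot> eta B"
      by (simp add: Comp_assoc)
    finally show ?thesis
      using m by (simp add: mod_unit_def)
  qed
  have eta': "\<pi> \<cdot> eta H = eta B" if "mod_unit \<gamma>" cocyc
    using that unfolding mod_unit_def cocyc_def by (intro pi_eta)
  show ?thesis
    unfolding 1 2 using alg mod unit cocyc eta eta' by blast
qed

end

section \<open>The isomorphism of categories\<close>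

lemma full_subcategory_hopf_pair:
  "full_subcategory (hopf_pair_category C hH hB P M) Q = hopf_pair_category C hH hB (\<lambda>x. P x \<and> Q x) M"
  by (auto simp: full_subcategory_def hopf_pair_category_def)

context strict_braided_monoidal_category
begin

text \<open>Identity laws and associativity hold componentwise in \<open>C\<close>; what depends on
  the structure is that \<open>M\<close> contains identities and is closed under
  composition.\<close>

lemma category_hopf_pair:
  assumes ob: "\<And>x. P x \<Longrightarrow> hopf_algebra C (hH x) \<and> hopf_algebra C (hB x)"
    and hom: "\<And>x y f g. M x y f g \<Longrightarrow> hopf_morphism C (hH x) (hH y) f \<and> hopf_morphism C (hB x) (hB y) g"
    and idt: "\<And>x. P x \<Longrightarrow> M x x (\<one> (carr (hH x))) (\<one> (carr (hB x)))"
    and comp: "\<And>x y z f g f' g'. \<lbrakk>P x; P y; P z; M x y f g; M y z f' g'\<rbrakk> \<Longrightarrow> M x z (f' \<cdot> f) (g' \<cdot> g)"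
  shows "category (hopf_pair_category C hH hB P M)"
proof -
  let ?D = "hopf_pair_category C hH hB P M"
  have hom': "f \<in> Arr C \<and> Dom C f = carr (hH x) \<and> Cod C f = carr (hH y) \<and>
      g \<in> Arr C \<and> Dom C g = carr (hB x) \<and> Cod C g = carr (hB y)" if "M x y f g" for x y f g
    using hom[OF that] hopf_morphism_simps(1-3) by blast
  have HomE: thesis
    if "F \<in> Hom\<^bsub>?D\<^esub> x y"
      "\<And>f g. \<lbrakk>F = (x, y, f, g); P x; P y; M x y f g; f \<in> Arr C; Dom C f = carr (hH x);
        Cod C f = carr (hH y); g \<in> Arr C; Dom C g = carr (hB x); Cod C g = carr (hB y)\<rbrakk> \<Longrightarrow> thesis"
    for F x y thesis
    using that hom' by (auto simp: hopf_pair_category_def Hom_def)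
  show ?thesis
  proof
    show "Dom ?D F \<in> Obj ?D" "Cod ?D F \<in> Obj ?D" if "F \<in> Arr ?D" for F
      using that by (auto simp: hopf_pair_category_def)
    show "\<one>\<^bsub>?D\<^esub> x \<in> Hom\<^bsub>?D\<^esub> x x" if "x \<in> Obj ?D" for x
      using that idt by (simp add: hopf_pair_category_def Hom_def)
    show "G \<cdot>\<^bsub>?D\<^esub> F \<in> Hom\<^bsub>?D\<^esub> x z" if "F \<in> Hom\<^bsub>?D\<^esub> x y" "G \<in> Hom\<^bsub>?D\<^esub> y z" for F G x y z
      using that(1)
    proof (rule HomE)
      fix f g assume 1: "F = (x, y, f, g)" "P x" "P y" "M x y f g"
      show ?thesis
        using that(2) by (rule HomE) (use 1 comp in \<open>simp add: hopf_pair_category_def Hom_def\<close>)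
    qed
    show "\<one>\<^bsub>?D\<^esub> y \<cdot>\<^bsub>?D\<^esub> F = F" "F \<cdot>\<^bsub>?D\<^esub> \<one>\<^bsub>?D\<^esub> x = F" if "F \<in> Hom\<^bsub>?D\<^esub> x y" for F x y
      using that by (rule HomE, simp add: hopf_pair_category_def)+
    show "(G' \<cdot>\<^bsub>?D\<^esub> G) \<cdot>\<^bsub>?D\<^esub> F = G' \<cdot>\<^bsub>?D\<^esub> (G \<cdot>\<^bsub>?D\<^esub> F)"
      if "F \<in> Hom\<^bsub>?D\<^esub> w x" "G \<in> Hom\<^bsub>?D\<^esub> x y" "G' \<in> Hom\<^bsub>?D\<^esub> y z" for F G G' w x y z
      using that(1) that(2) that(3)
      by (elim HomE) (simp add: hopf_pair_category_def Comp_assoc)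
  qed
qed

end

text \<open>Arrows record their source and target, so the functor changes these two entries and
  keeps the pair \<open>f\<close>, \<open>g\<close>. Preservation of the Hopf algebras makes
  identities match.\<close>

lemma is_functor_hopf_pair:
  assumes cat: "category (hopf_pair_category C hH hB P M)" "category (hopf_pair_category C hH' hB' P' M')"
    and F: "\<And>x. P x \<Longrightarrow> P' (F x) \<and> hH' (F x) = hH x \<and> hB' (F x) = hB x"
    and M: "\<And>x y f g. \<lbrakk>P x; P y; M x y f g\<rbrakk> \<Longrightarrow> M' (F x) (F y) f g"
  shows "is_functor (hopf_pair_category C hH hB P M) (hopf_pair_category C hH' hB' P' M')
    F (\<lambda>(x, y, f, g). (F x, F y, f, g))"
  unfolding is_functor_def using assms by (auto simp: hopf_pair_category_def Hom_def)

lemma isomorphic_hopf_pair_categories: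
  assumes cat: "category (hopf_pair_category C hH hB P M)" "category (hopf_pair_category C hH' hB' P' M')"
    and F: "\<And>x. P x \<Longrightarrow> P' (F x) \<and> hH' (F x) = hH x \<and> hB' (F x) = hB x \<and> G (F x) = x"
    and G: "\<And>x. P' x \<Longrightarrow> P (G x) \<and> F (G x) = x"
    and M: "\<And>x y f g. \<lbrakk>P x; P y\<rbrakk> \<Longrightarrow> M' (F x) (F y) f g \<longleftrightarrow> M x y f g"
  shows "isomorphic_categories (hopf_pair_category C hH hB P M) (hopf_pair_category C hH' hB' P' M')"
proof -
  have "is_functor (hopf_pair_category C hH hB P M) (hopf_pair_category C hH' hB' P' M')
      F (\<lambda>(x, y, f, g). (F x, F y, f, g))"
    using F M by (intro is_functor_hopf_pair cat) auto
  moreover have "is_functor (hopf_pair_category C hH' hB' P' M') (hopf_pair_category C hH hB P M)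
      G (\<lambda>(x, y, f, g). (G x, G y, f, g))"
    using F G M by (intro is_functor_hopf_pair cat) metis+
  ultimately show ?thesis
    unfolding isomorphic_categories_def using F G
    by (intro exI[of _ F] exI[of _ "\<lambda>(x, y, f, g). (F x, F y, f, g)"]
        exI[of _ G] exI[of _ "\<lambda>(x, y, f, g). (G x, G y, f, g)"])
      (auto simp: hopf_pair_category_def)
qed

section \<open>Recovering the coalgebra morphism from an action\<close>

context hopf_pair
begin

text \<open>The unit of \<open>B\<close> is grouplike, so inserting it is a coalgebra morphism from
  \<open>H\<close> to \<open>H \<otimes> B\<close>; composing with \<open>\<phi>\<close> preserves
  this.\<close>

lemma coalgebra_morphism_u:
  assumes phi: "coalgebra_morphism C HB (coalg_of B) \<phi>"
  shows "coalgebra_morphism C (coalg_of H) (coalg_of B) (\<phi> \<cdot> (\<one> (carr H) \<otimes> eta B))"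
proof -
  let ?H = "carr H" let ?B = "carr B" let ?u = "\<phi> \<cdot> (\<one> ?H \<otimes> eta B)" let ?t = "twist (coalg_of H) ?B"
  have [simp]: "\<phi> \<in> Arr C" "Dom C \<phi> = ?H \<otimes>\<^sub>o ?B" "Cod C \<phi> = ?B"
    using phi by (simp_all add: coalgebra_morphism_def Hom_iff)
  have "coalg_comult HB \<cdot> (\<one> ?H \<otimes> eta B) = (?t \<otimes> \<one> ?B) \<cdot> (\<one> ?H \<otimes> eta B \<otimes> eta B)"
    by (simp add: tensor_coalgebra_comult Comp_assoc Interchange hopf_unit)
  also have "\<dots> = (?t \<cdot> (\<one> ?H \<otimes> eta B)) \<otimes> eta B"
    using Interchange[of "\<one> ?H \<otimes> eta B" ?t "eta B" "\<one> ?B"] by simp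
  also have "?t \<cdot> (\<one> ?H \<otimes> eta B) = (\<one> ?H \<otimes> eta B \<otimes> \<one> ?H) \<cdot> delta H"
    using twist_natural_right[of "coalg_of H" "eta B"] by (simp add: twist_unit)
  also have "\<dots> \<otimes> eta B = (\<one> ?H \<otimes> eta B \<otimes> \<one> ?H \<otimes> eta B) \<cdot> delta H"
    using Interchange[of "delta H" "\<one> ?H \<otimes> eta B \<otimes> \<one> ?H" "\<one> K" "eta B"] by simp
  finally have d: "coalg_comult HB \<cdot> (\<one> ?H \<otimes> eta B) = (\<one> ?H \<otimes> eta B \<otimes> \<one> ?H \<otimes> eta B) \<cdot> delta H" .
  have "delta B \<cdot> ?u = (\<phi> \<otimes> \<phi>) \<cdot> (coalg_comult HB \<cdot> (\<one> ?H \<otimes> eta B))"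
    using phi coalgebra_simps[OF HB_HH_BB(1)] by (simp add: coalgebra_morphism_def flip: Comp_assoc)
  also have "\<dots> = ((\<phi> \<otimes> \<phi>) \<cdot> ((\<one> ?H \<otimes> eta B) \<otimes> (\<one> ?H \<otimes> eta B))) \<cdot> delta H"
    by (simp add: d Comp_assoc)
  also have "(\<phi> \<otimes> \<phi>) \<cdot> ((\<one> ?H \<otimes> eta B) \<otimes> (\<one> ?H \<otimes> eta B)) = ?u \<otimes> ?u"
    by (rule Interchange) simp_all
  finally have 1: "delta B \<cdot> ?u = (?u \<otimes> ?u) \<cdot> delta H" .
  have "eps B \<cdot> ?u = (eps H \<otimes> eps B) \<cdot> (\<one> ?H \<otimes> eta B)"
    using phi by (simp add: coalgebra_morphism_def flip: Comp_assoc)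
  also have "\<dots> = eps H"
    by (simp add: Interchange hopf_unit)
  finally show ?thesis
    using 1 by (simp add: coalgebra_morphism_def Hom_iff)
qed

end

context strict_braided_monoidal_category
begin

section \<open>The object maps and their mutual inverseness\<close>

definition bracoid_of :: "('o, 'm) cocycle \<Rightarrow> ('o, 'm) bracoid"
  where "bracoid_of c = \<lparr>br_H = cc_H c, br_B = cc_B c,
    br_phi = conv (alg_of (cc_B c)) (coalg_of (cc_H c)) K (carr (cc_B c)) (cc_pi c) (cc_gamma c)\<rparr>"

definition cocycle_of :: "('o, 'm) bracoid \<Rightarrow> ('o, 'm) cocycle"
  where "cocycle_of x = \<lparr>cc_H = br_H x, cc_B = br_B x,
    cc_gamma = bracoid_Phi C x, cc_pi = bracoid_u C x\<rparr>"

definition star_cocycle :: "('o, 'm) cocycle \<Rightarrow> bool"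
  where "star_cocycle c \<longleftrightarrow> one_cocycle C c \<and>
    coalgebra_morphism C (tensor_coalgebra C (coalg_of (cc_H c)) (coalg_of (cc_B c)))
      (coalg_of (cc_B c)) (cc_gamma c) \<and>
    star_condition C (cc_H c) (cc_B c) (cc_gamma c)"

definition star_bracoid :: "('o, 'm) bracoid \<Rightarrow> bool"
  where "star_bracoid x \<longleftrightarrow> hopf_bracoid C x \<and>
    coalgebra_morphism C (tensor_coalgebra C (coalg_of (br_H x)) (coalg_of (br_B x)))
      (coalg_of (br_B x)) (br_phi x) \<and>
    star_condition C (br_H x) (br_B x) (bracoid_Phi C x)"

lemma star_cocycle_factorization:
  assumes "star_cocycle c"
  shows "hopf_pair_factorization C (cc_H c) (cc_B c) (cc_pi c) (cc_gamma c)"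
  using assms
  by unfold_locales
    (simp_all add: star_cocycle_def one_cocycle_def left_module_algebra_def left_module_def Let_def)

lemma star_bracoid_of_cocycle:
  assumes "star_cocycle c"
  shows "star_bracoid (bracoid_of c) \<and> cocycle_of (bracoid_of c) = c"
proof -
  interpret c: hopf_pair_factorization C "cc_H c" "cc_B c" "cc_pi c" "cc_gamma c"
    by (rule star_cocycle_factorization) fact
  have b: "bracoid_of c = c.bracoid" and cc: "c.cocycle = c"
    by (simp_all add: bracoid_of_def c.phi_def)
  have star: "star_condition C (cc_H c) (cc_B c) (cc_gamma c)"
    using assms by (simp add: star_cocycle_def)
  have *: "hopf_bracoid C c.bracoid \<and> coalgebra_morphism C c.HB (coalg_of (cc_B c)) c.phi
      \<and> bracoid_u C c.bracoid = cc_pi c"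
    using assms c.cocycle_iff_bracoid[OF star] unfolding cc star_cocycle_def by blast
  then have "bracoid_Phi C c.bracoid = cc_gamma c"
    by (intro c.bracoid_Phi_eq) simp
  then show ?thesis
    using * star by (simp add: b star_bracoid_def cocycle_of_def)
qed

text \<open>The pair \<open>bracoid_u\<close>, \<open>bracoid_Phi\<close> is a factorization whose
  \<open>phi\<close> is the given action, so \<open>cocycle_iff_bracoid\<close> can be read from
  right to left.\<close>

lemma star_cocycle_of_bracoid:
  assumes "star_bracoid x"
  shows "star_cocycle (cocycle_of x) \<and> bracoid_of (cocycle_of x) = x"
proof -
  let ?H = "br_H x" let ?B = "br_B x" let ?u = "bracoid_u C x"
  interpret x: hopf_pair C ?H ?B
    using assms by unfold_locales (simp_all add: star_bracoid_def hopf_bracoid_def Let_def)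
  have phi: "coalgebra_morphism C x.HB (coalg_of ?B) (br_phi x)"
    using assms by (simp add: star_bracoid_def)
  have [simp]: "br_phi x \<in> Arr C" "Dom C (br_phi x) = carr ?H \<otimes>\<^sub>o carr ?B" "Cod C (br_phi x) = carr ?B"
    using phi by (simp_all add: coalgebra_morphism_def Hom_iff)
  have u: "coalgebra_morphism C (coalg_of ?H) (coalg_of ?B) ?u"
    unfolding bracoid_u_def by (rule x.coalgebra_morphism_u[OF phi])
  have [simp]: "?u \<in> Arr C" "Dom C ?u = carr ?H" "Cod C ?u = carr ?B"
    by (simp_all add: bracoid_u_def)
  have Phi: "bracoid_Phi C x = x.cnv K (carr ?B) (lam ?B \<cdot> ?u) (br_phi x)"
    by (simp add: bracoid_Phi_def x.cnv_eq)
  interpret x: hopf_pair_factorization C ?H ?B ?u "bracoid_Phi C x"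
    by unfold_locales (simp_all add: u, simp add: Phi Hom_iff)
  \<comment> \<open>Now the antipode composite is the inner factor, so it has to be a right
    convolution inverse of \<open>?u\<close>: hence the second part of
    \<open>conv_antipode\<close>.\<close>
  have p: "x.phi = br_phi x"
    unfolding x.phi_def
    unfolding Phi
    by (rule conv_cancel) (use conv_antipode(2)[OF x.B _ u] in simp_all)
  have b: "x.bracoid = x"
    by (simp add: p)
  have star: "star_condition C ?H ?B (bracoid_Phi C x)"
    using assms by (simp add: star_bracoid_def)
  have "one_cocycle C x.cocycle \<and> coalgebra_morphism C x.HB (coalg_of ?B) (bracoid_Phi C x)"
    using assms x.cocycle_iff_bracoid[OF star] phi unfolding b unfolding p star_bracoid_def by blast
  moreover have "bracoid_of (cocycle_of x) = x.bracoid"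
    by (simp add: bracoid_of_def cocycle_of_def x.phi_def)
  ultimately show ?thesis
    using star unfolding b by (simp add: star_cocycle_def cocycle_of_def)
qed

text \<open>Evaluating compatibility with the actions at the unit of \<open>B\<close> gives
  compatibility with \<open>\<pi>\<close>. Given the latter, both sides of the former are
  convolutions with the same left factor \<open>cc_pi d \<cdot> f\<close>, whose cancellation leaves
  compatibility with \<open>\<gamma>\<close>.\<close>

lemma bracoid_morphism_iff:
  assumes c: "star_cocycle c" and d: "star_cocycle d"
  shows "bracoid_morphism C (bracoid_of c) (bracoid_of d) f g \<longleftrightarrow> cocycle_morphism C c d f g"
proof (cases "hopf_morphism C (cc_H c) (cc_H d) f \<and> hopf_morphism C (cc_B c) (cc_B d) g")
  case False
  then show ?thesis
    by (auto simp: bracoid_morphism_def cocycle_morphism_def bracoid_of_def)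
next
  case True
  interpret c: hopf_pair_factorization C "cc_H c" "cc_B c" "cc_pi c" "cc_gamma c"
    by (rule star_cocycle_factorization) fact
  interpret d: hopf_pair_factorization C "cc_H d" "cc_B d" "cc_pi d" "cc_gamma d"
    by (rule star_cocycle_factorization) fact
  have f: "coalgebra_morphism C (coalg_of (cc_H c)) (coalg_of (cc_H d)) f"
    and g: "algebra_morphism C (alg_of (cc_B c)) (alg_of (cc_B d)) g"
    using True by (simp_all add: hopf_morphism_def)
  have [simp]: "f \<in> Arr C" "Dom C f = carr (cc_H c)" "Cod C f = carr (cc_H d)"
    "g \<in> Arr C" "Dom C g = carr (cc_B c)" "Cod C g = carr (cc_B d)" and ge: "g \<cdot> eta (cc_B c) = eta (cc_B d)"
    using True hopf_morphism_simps by blast+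
  let ?cv = "conv (alg_of (cc_B d)) (coalg_of (cc_H c)) K (carr (cc_B c))"
  have l: "g \<cdot> c.phi = ?cv (g \<cdot> cc_pi c) (g \<cdot> cc_gamma c)"
    unfolding c.phi_def by (rule conv_algebra_morphism[OF _ _ _ g]) simp_all
  have r: "d.phi \<cdot> (f \<otimes> g) = ?cv (cc_pi d \<cdot> f) (cc_gamma d \<cdot> (f \<otimes> g))"
    using conv_comp[OF _ _ _ f, of "alg_of (cc_B d)" "\<one> K" g "cc_pi d" "cc_gamma d"]
    by (simp add: d.phi_def)
  have "g \<cdot> c.phi = d.phi \<cdot> (f \<otimes> g) \<longleftrightarrow>
      cc_pi d \<cdot> f = g \<cdot> cc_pi c \<and> g \<cdot> cc_gamma c = cc_gamma d \<cdot> (f \<otimes> g)" (is "?phi \<longleftrightarrow> ?pi \<and> ?gamma")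
  proof -
    have "?pi" if ?phi
    proof -
      have u: "c.phi \<cdot> (\<one> (carr (cc_H c)) \<otimes> eta (cc_B c)) = cc_pi c"
        "d.phi \<cdot> (\<one> (carr (cc_H d)) \<otimes> eta (cc_B d)) = cc_pi d"
        using c d by (simp_all add: c.unit_iff d.unit_iff star_cocycle_def one_cocycle_def
            left_module_algebra_def Let_def)
      have "g \<cdot> cc_pi c = (g \<cdot> c.phi) \<cdot> (\<one> (carr (cc_H c)) \<otimes> eta (cc_B c))"
        by (simp add: Comp_assoc u)
      also have "\<dots> = d.phi \<cdot> (f \<otimes> eta (cc_B d))"
        unfolding that by (simp add: Comp_assoc Interchange ge)
      also have "f \<otimes> eta (cc_B d) = (\<one> (carr (cc_H d)) \<otimes> eta (cc_B d)) \<cdot> f"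
        using Interchange[of f "\<one> (carr (cc_H d))" "\<one> K" "eta (cc_B d)"] by simp
      also have "d.phi \<cdot> \<dots> = cc_pi d \<cdot> f"
        by (simp add: u flip: Comp_assoc)
      finally show ?thesis ..
    qed
    moreover have "?phi \<longleftrightarrow> ?gamma" if ?pi
    proof -
      have "coalgebra_morphism C (coalg_of (cc_H c)) (coalg_of (cc_B d)) (cc_pi d \<cdot> f)"
        using f d.pi by (intro coalgebra_morphism_Comp[of _ "coalg_of (cc_H d)"]) simp_all
      then show ?thesis
        unfolding l r that[symmetric]
        using conv_left_cancel[OF d.B _ _ _ algebra_morphism_Ident, of "coalg_of (cc_H c)" "cc_pi d \<cdot> f"
            "carr (cc_B c)" "g \<cdot> cc_gamma c" "cc_gamma d \<cdot> (f \<otimes> g)"]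
        by auto
    qed
    ultimately show ?thesis by blast
  qed
  then show ?thesis
    using True
    by (simp add: bracoid_morphism_def cocycle_morphism_def bracoid_of_def flip: c.phi_def d.phi_def)
qed

section \<open>Both starred subcategories are categories, and they are isomorphic\<close>

lemma OneC_star_eq: "OneC_star C = hopf_pair_category C cc_H cc_B star_cocycle (cocycle_morphism C)"
  by (simp add: OneC_star_def OneC_def full_subcategory_hopf_pair star_cocycle_def[abs_def])

lemma HBrcd_star_eq: "HBrcd_star C = hopf_pair_category C br_H br_B star_bracoid (bracoid_morphism C)"
  by (simp add: HBrcd_star_def HBrcd_def full_subcategory_hopf_pair star_bracoid_def[abs_def])

lemma category_HBrcd_star: "category (HBrcd_star C)"
  unfolding HBrcd_star_eq
proof (rule category_hopf_pair)
  show ob: "hopf_algebra C (br_H x) \<and> hopf_algebra C (br_B x)" if "star_bracoid x" for x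
    using that by (simp add: star_bracoid_def hopf_bracoid_def Let_def)
  have phi: "br_phi x \<in> Arr C" "Dom C (br_phi x) = carr (br_H x) \<otimes>\<^sub>o carr (br_B x)"
      "Cod C (br_phi x) = carr (br_B x)" if "star_bracoid x" for x
    using that by (simp_all add: star_bracoid_def coalgebra_morphism_def Hom_iff)
  show "hopf_morphism C (br_H x) (br_H y) f \<and> hopf_morphism C (br_B x) (br_B y) g"
    if "bracoid_morphism C x y f g" for x y f g
    using that by (simp add: bracoid_morphism_def)
  show "bracoid_morphism C x x (\<one> (carr (br_H x))) (\<one> (carr (br_B x)))" if "star_bracoid x" for x
    using ob[OF that] phi[OF that] by (simp add: bracoid_morphism_def hopf_morphism_Ident)
  show "bracoid_morphism C x z (f' \<cdot> f) (g' \<cdot> g)"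
    if P: "star_bracoid x" "star_bracoid y" "star_bracoid z"
      and fg: "bracoid_morphism C x y f g" and fg': "bracoid_morphism C y z f' g'" for x y z f g f' g'
  proof -
    note [simp] = phi[OF P(1)] phi[OF P(2)] phi[OF P(3)]
    have h: "hopf_morphism C (br_H x) (br_H y) f" "hopf_morphism C (br_B x) (br_B y) g"
      "hopf_morphism C (br_H y) (br_H z) f'" "hopf_morphism C (br_B y) (br_B z) g'"
      and c: "g \<cdot> br_phi x = br_phi y \<cdot> (f \<otimes> g)" "g' \<cdot> br_phi y = br_phi z \<cdot> (f' \<otimes> g')"
      using fg fg' by (simp_all add: bracoid_morphism_def)
    note [simp] = h[THEN hopf_morphism_simps(1)] h[THEN hopf_morphism_simps(2)]
      h[THEN hopf_morphism_simps(3)]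
    have "(g' \<cdot> g) \<cdot> br_phi x = (g' \<cdot> br_phi y) \<cdot> (f \<otimes> g)"
      by (simp add: Comp_assoc c(1))
    also have "\<dots> = br_phi z \<cdot> ((f' \<cdot> f) \<otimes> (g' \<cdot> g))"
      unfolding c(2) by (simp add: Comp_assoc Interchange)
    finally show ?thesis
      using h ob[OF P(1)] ob[OF P(2)] ob[OF P(3)]
      by (auto simp: bracoid_morphism_def intro: hopf_morphism_Comp)
  qed
qed

text \<open>Identities and composites are transported from the bracoid side along
  \<open>bracoid_morphism_iff\<close> instead of being checked for \<open>\<pi>\<close> and
  \<open>\<gamma>\<close> separately.\<close>

lemma category_OneC_star: "category (OneC_star C)"
  unfolding OneC_star_eq
proof (rule category_hopf_pair)
  have H: "br_H (bracoid_of c) = cc_H c" and B: "br_B (bracoid_of c) = cc_B c" for c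
    by (simp_all add: bracoid_of_def)
  interpret HBrcd: category "HBrcd_star C"
    by (rule category_HBrcd_star)
  show ob: "hopf_algebra C (cc_H c) \<and> hopf_algebra C (cc_B c)" if "star_cocycle c" for c
    using that by (simp add: star_cocycle_def one_cocycle_def Let_def)
  show "hopf_morphism C (cc_H x) (cc_H y) f \<and> hopf_morphism C (cc_B x) (cc_B y) g"
    if "cocycle_morphism C x y f g" for x y f g
    using that by (simp add: cocycle_morphism_def)
  show "cocycle_morphism C x x (\<one> (carr (cc_H x))) (\<one> (carr (cc_B x)))" if "star_cocycle x" for x
    using HBrcd.ident_hom[of "bracoid_of x"] star_bracoid_of_cocycle[OF that]
      bracoid_morphism_iff[OF that that]
    by (simp add: HBrcd_star_eq hopf_pair_category_def Hom_def H B)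
  show "cocycle_morphism C x z (f' \<cdot> f) (g' \<cdot> g)"
    if P: "star_cocycle x" "star_cocycle y" "star_cocycle z"
      and "cocycle_morphism C x y f g" "cocycle_morphism C y z f' g'" for x y z f g f' g'
    using that HBrcd.comp_hom[of "(bracoid_of x, bracoid_of y, f, g)" "bracoid_of x" "bracoid_of y"
        "(bracoid_of y, bracoid_of z, f', g')" "bracoid_of z"] P[THEN star_bracoid_of_cocycle]
    by (simp add: HBrcd_star_eq hopf_pair_category_def Hom_def bracoid_morphism_iff)
qed

end

theorem theorem3p8:
  fixes C :: "('o, 'm) braided_category"
  assumes "strict_braided_monoidal_category C"
  shows "isomorphic_categories (OneC_star C) (HBrcd_star C)"
proof -
  interpret strict_braided_monoidal_category C by fact
  show ?thesis
    using category_OneC_star category_HBrcd_star star_bracoid_of_cocycle star_cocycle_of_bracoid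
      bracoid_morphism_iff
    unfolding OneC_star_eq HBrcd_star_eq
    by (intro isomorphic_hopf_pair_categories[where F = bracoid_of and G = cocycle_of])
      (auto simp: bracoid_of_def)
qed

end
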